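(* Let $K$ be a convex body in $\mathbb{R}^n$ that is symmetric about the origin ($K=-K$). For all $t\in\mathbb{R}$ with $S(K,t)\ne\emptyset$ (equivalently $t\ge \frac{|K||K^0|}{v_n^2}$), $$d_n(t)\,E(K^0)\subseteq S(K,t)\subseteq c_n(t)\,E(K^0),$$ where $$d_n(t)=\frac{1}{\sqrt3\,n}\left(1-\frac{|K||K^0|}{t v_n^2}\right)^{\frac12}$$ and $$c_n(t)=\min\left\{\left(\frac{2}{(n+1)(n+2)}\right)^{\frac12}\left(\frac{t v_n^2}{|K||K^0|}\right)^{\frac12}\left(1-\frac{|K||K^0|}{t v_n^2}\right)^{\frac12},\ \sqrt2\left(1-\left(\frac{|K||K^0|}{t v_n^2}\right)^{\frac1n}\right)^{\frac12}\right\}.$$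
   Context: A convex body is a compact convex set with non-empty interior. $|\cdot|$ denotes $n$-dimensional volume and $v_n$ the volume of the Euclidean unit ball of $\mathbb{R}^n$. For $x\in K$, $K^x=\{y\in\mathbb{R}^n:\langle y,z-x\rangle\le 1\text{ for all }z\in K\}$ is the polar body of $K$ with respect to $x$ (of infinite volume if $x\in\partial K$); $K^0$ is the polar with respect to the origin. For $t\in\mathbb{R}$ the Santaló-region is $$S(K,t)=\Bigl\{x\in K:\ \frac{|K|\,|K^x|}{v_n^2}\le t\Bigr\}.$$ For a convex body $L$ in $\mathbb{R}^n$, the Binet ellipsoid $E(L)$ is the ellipsoid centered at the origin whose norm (i.e. the norm having $E(L)$ as unit ball) is given by $\|u\|_{E(L)}^2=\frac1{|L|}\int_L\langle x,u\rangle^2dx$ for $u\in\mathbb{R}^n$. *)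

theory Defs
  imports "HOL-Analysis.Analysis"
begin

definition convex_body :: "'a::euclidean_space set \<Rightarrow> bool" where
  "convex_body K \<longleftrightarrow> compact K \<and> convex K \<and> interior K \<noteq> {}"

definition polar_body :: "'a::euclidean_space set \<Rightarrow> 'a \<Rightarrow> 'a set" where
  "polar_body K x = {y. \<forall>z\<in>K. y \<bullet> (z - x) \<le> 1}"

definition euclidean_ball_vol :: "'a::euclidean_space itself \<Rightarrow> real" where
  "euclidean_ball_vol _ = measure lebesgue (cball (0::'a) 1)"

(* The polar with respect to a boundary point has infinite volume, to which measure would
   assign 0. Hence the volumes are taken in ennreal, and the comparison with the arbitrary
   real number t is made in ereal (negative t would be truncated in ennreal). *)
definition santalo_region :: "'a::euclidean_space set \<Rightarrow> real \<Rightarrow> 'a set" where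
  "santalo_region K t =
     {x \<in> K. enn2ereal (emeasure lebesgue K * emeasure lebesgue (polar_body K x)
                 / ennreal ((euclidean_ball_vol TYPE('a))\<^sup>2)) \<le> ereal t}"

definition binet_norm :: "'a::euclidean_space set \<Rightarrow> 'a \<Rightarrow> real" where
  "binet_norm L u =
     sqrt (1 / measure lebesgue L * set_lebesgue_integral lebesgue L (\<lambda>x. (x \<bullet> u)\<^sup>2))"

definition binet_ellipsoid :: "'a::euclidean_space set \<Rightarrow> 'a set" where
  "binet_ellipsoid L = {u. binet_norm L u \<le> 1}"

(* |K| |K^0|; the polar with respect to the origin has finite volume when the origin is an
   interior point of K, as is the case for an origin-symmetric convex body. *)
definition volume_product :: "'a::euclidean_space set \<Rightarrow> real" where
  "volume_product K = measure lebesgue K * measure lebesgue (polar_body K 0)"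

definition inner_factor :: "'a::euclidean_space set \<Rightarrow> real \<Rightarrow> real" where
  "inner_factor K t =
     1 / (sqrt 3 * real DIM('a))
       * sqrt (1 - volume_product K / (t * (euclidean_ball_vol TYPE('a))\<^sup>2))"

definition outer_factor :: "'a::euclidean_space set \<Rightarrow> real \<Rightarrow> real" where
  "outer_factor K t =
     (let n = real DIM('a);
          v = euclidean_ball_vol TYPE('a)
      in min (sqrt (2 / ((n + 1) * (n + 2)))
                * sqrt (t * v\<^sup>2 / volume_product K)
                * sqrt (1 - volume_product K / (t * v\<^sup>2)))
             (sqrt 2 * sqrt (1 - (volume_product K / (t * v\<^sup>2)) powr (1 / n))))"

end

theory Submission
  imports Defs "HOL-Probability.Distributions"
begin

text \<open>
  Write \<open>n\<close> for the dimension, \<open>L\<close> for the polar body of \<open>K\<close> with respect to the origin, and let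
  \<open>s = \<langle>x, y\<rangle>\<close> be viewed as a random variable on \<open>L\<close> with the uniform distribution; its second moment
  \<open>a = E s\<^sup>2\<close> is the square of the Binet norm of \<open>x\<close>. For \<open>x \<in> K\<close> the volume of the polar body with
  respect to \<open>x\<close> is \<open>|L| E (1 - s)\<^bsup>-(n+1)\<^esup>\<close> (theorem \<open>emeasure_polar_body\<close>), and since \<open>L\<close> is
  symmetric the integrand may be replaced by its even part \<open>G(s)\<close>. The theorem thus amounts to bounds of \<open>E G(s)\<close> in terms of
  \<open>a\<close>: with \<open>q = |K| |L| / (t v\<^sup>2)\<close>, membership of \<open>x\<close> in the Santalo region means \<open>E G(s) \<le> 1/q\<close>.

  The outer inclusion needs lower bounds. Both come from pointwise inequalities on \<open>(-1,1)\<close>: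
  \<open>G(s) \<ge> 1 + (n+1)(n+2)/2 s\<^sup>2\<close> gives the first expression in the minimum, and
  \<open>G(s) \<ge> (1 - s\<^sup>2/2)\<^bsup>-(n+1)\<^esup>\<close>, a convex function of \<open>s\<^sup>2\<close>, gives the second one by Jensen's inequality.

  The inner inclusion needs an upper bound, and here the convexity of \<open>L\<close> enters. With
  \<open>\<rho>\<^sup>2 = (n+1)(n+2)/2 a\<close> the sharp bound is \<open>E G(s) \<le> 1 / (1 - \<rho>\<^sup>2)\<close>, attained by double cones, for which
  the tail \<open>P(|s| \<ge> r)\<close> equals \<open>(1 - r/\<rho>)\<^sup>n\<close>. By the Brunn--Minkowski inequality the \<open>n\<close>-th root of the
  tail of any symmetric convex body lies above its chords from \<open>r = 0\<close>
  (theorem \<open>slab_tail_concave\<close>). Hence the tail is at first above and then below the tail of the double cone with the same second moment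
  \<open>E s\<^sup>2 = \<integral> 2 r P(|s| \<ge> r) dr\<close>. As \<open>G'(r) / r\<close> is increasing, it follows that
  \<open>E G(s) = 1 + \<integral> G'(r) P(|s| \<ge> r) dr\<close> is at most the value for this double cone.
  Since \<open>(n+1)(n+2)/2 \<le> 3 n\<^sup>2\<close>, the bound \<open>a \<le> (1-q)/(3 n\<^sup>2)\<close>
  leads to \<open>E G(s) \<le> 1/q\<close>; the same concavity of the tail shows \<open>|s| \<le> \<rho> < 1\<close> on \<open>L\<close>, whence \<open>x \<in> K\<close>.

  The Brunn--Minkowski inequality is proved by the argument of Hadwiger and Ohmann: an induction on the
  number of boxes for finite unions of disjoint boxes, followed by approximation from inside.
\<close>

section \<open>The Brunn--Minkowski inequality\<close>

lemma negligible_imp_null_lborel: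
  assumes "negligible S" "S \<in> sets borel" shows "S \<in> null_sets lborel"
  using assms by (auto simp: negligible_iff_null_sets null_sets_def)

lemma AE_lborel_inner_neq:
  fixes x :: "'a::euclidean_space"
  assumes "x \<noteq> 0 \<or> c \<noteq> 0"
  shows "AE y in lborel. x \<bullet> y \<noteq> c"
proof -
  have "{y. x \<bullet> y = c} \<in> sets borel" by measurable
  then have "{y. x \<bullet> y = c} \<in> null_sets lborel"
    using negligible_hyperplane[OF assms] by (intro negligible_imp_null_lborel)
  then have "AE y in lborel. y \<notin> {y. x \<bullet> y = c}" by (rule AE_not_in)
  then show ?thesis by simp
qed

lemma measure_split_halfspaces:
  fixes B :: "'a::euclidean_space set"
  assumes B: "B \<in> fmeasurable lborel" and x: "x \<noteq> 0"
  shows "measure lborel B = measure lborel (B \<inter> {y. x \<bullet> y < c}) + measure lborel (B \<inter> {y. c < x \<bullet> y})"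
proof -
  have [measurable]: "B \<in> sets borel" using B by (auto simp: fmeasurable_def)
  have s: "{y. x \<bullet> y < c} \<in> sets lborel" "{y. c < x \<bullet> y} \<in> sets lborel" by measurable
  have "measure lborel B = measure lborel ((B \<inter> {y. x \<bullet> y < c}) \<union> (B \<inter> {y. c < x \<bullet> y}))"
    using AE_lborel_inner_neq[of x c] x
    by (intro measure_eq_AE) auto
  also have "\<dots> = measure lborel (B \<inter> {y. x \<bullet> y < c}) + measure lborel (B \<inter> {y. c < x \<bullet> y})"
    using fmeasurable_Int_fmeasurable[OF B s(1)] fmeasurable_Int_fmeasurable[OF B s(2)]
    by (intro measure_Union) (auto simp: fmeasurable_def less_top)
  finally show ?thesis .
qed

text \<open>If \<open>c\<^sub>k\<close> tends to \<open>c\<close>, the indicator functions of the half-spaces converge off the hyperplane at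
  level \<open>c\<close>, which is a null set.\<close>

lemma continuous_measure_halfspace:
  fixes B :: "'a::euclidean_space set"
  assumes B: "B \<in> fmeasurable lborel" and x: "x \<noteq> 0"
  shows "continuous_on UNIV (\<lambda>c. measure lborel (B \<inter> {y. x \<bullet> y < c}))"
proof -
  have [measurable]: "B \<in> sets borel" using B by (auto simp: fmeasurable_def)
  have fin: "integrable lborel (indicat_real B)"
    using B by (intro integrable_real_indicator) (auto simp: fmeasurable_def)
  have eq: "measure lborel (B \<inter> {y. x \<bullet> y < c}) = (\<integral>y. indicat_real (B \<inter> {y. x \<bullet> y < c}) y \<partial>lborel)" for c
    by simp
  have "(\<lambda>k. measure lborel (B \<inter> {y. x \<bullet> y < u k})) \<longlonglongrightarrow> measure lborel (B \<inter> {y. x \<bullet> y < c})"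
    if u: "u \<longlonglongrightarrow> c" for u c
    unfolding eq
  proof (rule integral_dominated_convergence[where w = "indicat_real B"])
    show "AE y in lborel. (\<lambda>k. indicat_real (B \<inter> {y. x \<bullet> y < u k}) y) \<longlonglongrightarrow> indicat_real (B \<inter> {y. x \<bullet> y < c}) y"
      using AE_lborel_inner_neq[of x c]
    proof (rule AE_mp, use x in simp, intro AE_I2 impI)
      fix y assume ne: "x \<bullet> y \<noteq> c"
      have "\<forall>\<^sub>F k in sequentially. (x \<bullet> y < u k) = (x \<bullet> y < c)"
      proof (cases "x \<bullet> y < c")
        case True
        then show ?thesis using order_tendstoD(1)[OF u True] by (auto elim: eventually_mono)
      next
        case False
        with ne have "c < x \<bullet> y" by simp
        from order_tendstoD(2)[OF u this] False show ?thesis by (auto elim!: eventually_mono)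
      qed
      then show "(\<lambda>k. indicat_real (B \<inter> {y. x \<bullet> y < u k}) y) \<longlonglongrightarrow> indicat_real (B \<inter> {y. x \<bullet> y < c}) y"
        by (intro tendsto_eventually) (auto elim!: eventually_mono simp: indicator_def)
    qed
  qed (use fin in \<open>auto simp: indicator_def\<close>)
  then show ?thesis
    by (auto simp: continuous_on_sequentially o_def)
qed

text \<open>This is Brunn--Minkowski for boxes with edge lengths \<open>p\<close> and \<open>q\<close>. After division by the right-hand
  side it is the inequality between geometric and arithmetic mean, applied to the ratios \<open>p/(p+q)\<close> and
  \<open>q/(p+q)\<close>, whose arithmetic means add up to 1.\<close>

lemma root_prod_add_le:
  fixes p q :: "'a \<Rightarrow> real"
  assumes I: "finite I" "I \<noteq> {}" and p: "\<And>i. i \<in> I \<Longrightarrow> 0 < p i" and q: "\<And>i. i \<in> I \<Longrightarrow> 0 < q i"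
  shows "(root (card I) (\<Prod>i\<in>I. p i) + root (card I) (\<Prod>i\<in>I. q i)) ^ card I \<le> (\<Prod>i\<in>I. p i + q i)"
proof -
  let ?n = "card I" and ?R = "\<Prod>i\<in>I. p i + q i"
  have n: "0 < ?n" using I by (simp add: card_gt_0_iff)
  have R: "0 < ?R" using p q by (intro prod_pos) (auto intro: add_pos_pos)
  have amgm: "root ?n (\<Prod>i\<in>I. f i / (p i + q i)) \<le> (\<Sum>i\<in>I. f i / (p i + q i) / ?n)"
    if "\<And>i. i \<in> I \<Longrightarrow> 0 < f i" for f
  proof -
    have "0 < (\<Prod>i\<in>I. f i / (p i + q i))"
      using that p q by (intro prod_pos) (auto intro!: divide_pos_pos add_pos_pos)
    moreover have "\<And>i. i \<in> I \<Longrightarrow> 0 \<le> f i / (p i + q i)"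
      using that p q by (force intro!: divide_nonneg_nonneg add_nonneg_nonneg less_imp_le)
    ultimately show ?thesis
      using arith_geom_mean[OF I, of "\<lambda>i. f i / (p i + q i)"] n
      by (simp add: root_powr_inverse)
  qed
  have "root ?n (\<Prod>i\<in>I. p i / (p i + q i)) + root ?n (\<Prod>i\<in>I. q i / (p i + q i))
      \<le> (\<Sum>i\<in>I. p i / (p i + q i) / ?n) + (\<Sum>i\<in>I. q i / (p i + q i) / ?n)"
    by (intro add_mono amgm p q)
  also have "\<dots> = (\<Sum>i\<in>I. 1 / ?n)"
    unfolding sum.distrib[symmetric]
  proof (intro sum.cong refl)
    fix i assume "i \<in> I"
    then have "p i + q i \<noteq> 0" using p q by (metis add_pos_pos less_irrefl)
    then show "p i / (p i + q i) / real ?n + q i / (p i + q i) / real ?n = 1 / real ?n"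
      by (metis add_divide_distrib divide_self)
  qed
  also have "\<dots> = 1" using n by simp
  finally have "root ?n (\<Prod>i\<in>I. p i) / root ?n ?R + root ?n (\<Prod>i\<in>I. q i) / root ?n ?R \<le> 1"
    by (simp add: prod_dividef real_root_divide)
  then have "root ?n (\<Prod>i\<in>I. p i) + root ?n (\<Prod>i\<in>I. q i) \<le> root ?n ?R"
    using R n by (simp add: field_simps)
  then have "(root ?n (\<Prod>i\<in>I. p i) + root ?n (\<Prod>i\<in>I. q i)) ^ ?n \<le> root ?n ?R ^ ?n"
    using p q by (intro power_mono add_nonneg_nonneg real_root_ge_zero prod_nonneg) (auto intro: less_imp_le)
  also have "\<dots> = ?R" using n R by simp
  finally show ?thesis .
qed

lemma open_set_plus:
  fixes A B :: "'a::euclidean_space set"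
  assumes "open A" "open B" shows "open (A + B)"
proof -
  have "A + B = (\<Union>x\<in>A. \<Union>y\<in>B. {x + y})" by (auto simp: set_plus_def)
  then show ?thesis using open_sums[of A B] assms by simp
qed

lemma bounded_set_plus:
  fixes A B :: "'a::euclidean_space set"
  assumes "bounded A" "bounded B" shows "bounded (A + B)"
  using bounded_plus[OF assms] by (simp add: set_plus_image)

lemma open_bounded_fmeasurable:
  fixes A :: "'a::euclidean_space set"
  assumes "open A" "bounded A" shows "A \<in> fmeasurable lborel"
  using assms emeasure_bounded_finite[of A] by (auto simp: fmeasurable_def)

lemma measure_lborel_open_pos:
  fixes A :: "'a::euclidean_space set"
  assumes A: "A \<in> fmeasurable lborel" "open A" "A \<noteq> {}"
  shows "0 < measure lborel A"
proof -
  from A obtain x e where e: "0 < e" "ball x e \<subseteq> A"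
    by (meson all_not_in_conv openE)
  have "0 < measure lborel (ball x e)" using content_ball_pos[OF e(1), of x] by simp
  also have "\<dots> \<le> measure lborel A"
    using e A by (intro measure_mono_fmeasurable) auto
  finally show ?thesis .
qed

text \<open>Cutting both summands by parallel hyperplanes puts the two partial sums on different sides
  of a third hyperplane, so their volumes add up.\<close>

lemma measure_set_plus_halfspaces:
  fixes A B :: "'a::euclidean_space set" and i :: 'a and c e :: real
  assumes A: "open A" "bounded A" and B: "open B" "bounded B"
  defines "lo \<equiv> \<lambda>c. {y. i \<bullet> y < c}" and "hi \<equiv> \<lambda>c. {y. c < i \<bullet> y}"
  shows "measure lborel (A \<inter> lo c + B \<inter> lo e) + measure lborel (A \<inter> hi c + B \<inter> hi e)
       \<le> measure lborel (A + B)"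
proof -
  have ops: "open (lo c)" "open (hi c)" for c
    unfolding lo_def hi_def by (auto intro: open_halfspace_lt open_halfspace_gt)
  have m: "A \<inter> lo c + B \<inter> lo e \<in> fmeasurable lborel" "A \<inter> hi c + B \<inter> hi e \<in> fmeasurable lborel"
      "A + B \<in> fmeasurable lborel"
    using A B ops by (auto intro!: open_bounded_fmeasurable open_set_plus bounded_set_plus bounded_Int open_Int)
  have "measure lborel (A \<inter> lo c + B \<inter> lo e) + measure lborel (A \<inter> hi c + B \<inter> hi e)
      = measure lborel ((A \<inter> lo c + B \<inter> lo e) \<union> (A \<inter> hi c + B \<inter> hi e))"
  proof (intro measure_Union[symmetric])
    have "A \<inter> lo c + B \<inter> lo e \<subseteq> lo (c + e)" "A \<inter> hi c + B \<inter> hi e \<subseteq> hi (c + e)"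
      by (auto simp: set_plus_def lo_def hi_def inner_add_right)
    then show "(A \<inter> lo c + B \<inter> lo e) \<inter> (A \<inter> hi c + B \<inter> hi e) = {}"
      by (fastforce simp: lo_def hi_def)
  qed (use m in \<open>auto simp: fmeasurable_def less_top\<close>)
  also have "\<dots> \<le> measure lborel (A + B)"
  proof (rule measure_mono_fmeasurable)
    show "(A \<inter> lo c + B \<inter> lo e) \<union> (A \<inter> hi c + B \<inter> hi e) \<subseteq> A + B" by (auto simp: set_plus_def)
  qed (use m in \<open>auto simp: fmeasurable_def\<close>)
  finally show ?thesis .
qed

text \<open>A finite disjoint union of open boxes is represented by the set of its boxes, because the
  induction below is on their number.\<close>

definition box_family :: "'a::euclidean_space set set \<Rightarrow> bool" where
  "box_family \<A> \<longleftrightarrow> finite \<A> \<and> disjoint \<A> \<and> (\<forall>X\<in>\<A>. X \<noteq> {} \<and> (\<exists>a b. X = box a b))"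

text \<open>Empty traces are discarded, so that the number of boxes drops when one of them lies off \<open>H\<close>.\<close>

definition traces :: "'a set \<Rightarrow> 'a set set \<Rightarrow> 'a set set" where
  "traces H \<A> = (\<lambda>X. X \<inter> H) ` \<A> - {{}}"

lemma Union_traces: "\<Union>(traces H \<A>) = \<Union>\<A> \<inter> H"
  by (auto simp: traces_def)

lemma card_traces_le: "finite \<A> \<Longrightarrow> card (traces H \<A>) \<le> card \<A>"
  unfolding traces_def by (meson card_Diff1_le card_image_le finite_imageI le_trans)

lemma card_traces_less:
  assumes "finite \<A>" "X \<in> \<A>" "X \<inter> H = {}" shows "card (traces H \<A>) < card \<A>"
proof -
  have "traces H \<A> \<subseteq> (\<lambda>X. X \<inter> H) ` (\<A> - {X})" using assms by (auto simp: traces_def)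
  then have "card (traces H \<A>) \<le> card (\<A> - {X})"
    using assms by (meson card_image_le card_mono finite_Diff finite_imageI le_trans)
  also have "\<dots> < card \<A>" using assms by (meson card_Diff1_less)
  finally show ?thesis .
qed

lemma box_Int_lo:
  fixes i :: "'a::euclidean_space"
  assumes "i \<in> Basis"
  shows "\<exists>b'. box a b \<inter> {y. i \<bullet> y < c} = box a b'"
proof
  have eq: "{y. i \<bullet> y < c} = {y. y \<bullet> i < c}" by (simp add: inner_commute)
  show "box a b \<inter> {y. i \<bullet> y < c} = box a (\<Sum>j\<in>Basis. (if j = i then min (b \<bullet> i) c else b \<bullet> j) *\<^sub>R j)"
    unfolding eq using assms by (force simp: mem_box split: if_splits)
qed

lemma box_Int_hi:
  fixes i :: "'a::euclidean_space"
  assumes "i \<in> Basis"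
  shows "\<exists>a'. box a b \<inter> {y. c < i \<bullet> y} = box a' b"
proof
  have eq: "{y. c < i \<bullet> y} = {y. c < y \<bullet> i}" by (simp add: inner_commute)
  show "box a b \<inter> {y. c < i \<bullet> y} = box (\<Sum>j\<in>Basis. (if j = i then max (a \<bullet> i) c else a \<bullet> j) *\<^sub>R j) b"
    unfolding eq using assms by (force simp: mem_box split: if_splits)
qed

lemma box_family_traces:
  fixes i :: "'a::euclidean_space"
  assumes "box_family \<A>" "i \<in> Basis"
  shows "box_family (traces {y. i \<bullet> y < c} \<A>)" "box_family (traces {y. c < i \<bullet> y} \<A>)"
proof -
  have d: "disjoint (traces H \<A>)" for H
    using assms(1) unfolding box_family_def traces_def pairwise_def disjnt_def by fastforce
  show "box_family (traces {y. i \<bullet> y < c} \<A>)"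
    unfolding box_family_def
  proof (intro conjI d ballI)
    fix Y assume "Y \<in> traces {y. i \<bullet> y < c} \<A>"
    then obtain X where X: "X \<in> \<A>" "Y = X \<inter> {y. i \<bullet> y < c}" and "Y \<noteq> {}"
      by (auto simp: traces_def)
    moreover obtain a b where "X = box a b" using X(1) assms(1) unfolding box_family_def by blast
    ultimately have "Y \<noteq> {}" "Y = box a b \<inter> {y. i \<bullet> y < c}" by simp_all
    then show "Y \<noteq> {}" "\<exists>a b. Y = box a b" using box_Int_lo[OF assms(2), of a b c] by auto
  qed (use assms(1) in \<open>auto simp: traces_def box_family_def\<close>)
  show "box_family (traces {y. c < i \<bullet> y} \<A>)"
    unfolding box_family_def
  proof (intro conjI d ballI)
    fix Y assume "Y \<in> traces {y. c < i \<bullet> y} \<A>"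
    then obtain X where X: "X \<in> \<A>" "Y = X \<inter> {y. c < i \<bullet> y}" and "Y \<noteq> {}"
      by (auto simp: traces_def)
    moreover obtain a b where "X = box a b" using X(1) assms(1) unfolding box_family_def by blast
    ultimately have "Y \<noteq> {}" "Y = box a b \<inter> {y. c < i \<bullet> y}" by simp_all
    then show "Y \<noteq> {}" "\<exists>a b. Y = box a b" using box_Int_hi[OF assms(2), of a b c] by auto
  qed (use assms(1) in \<open>auto simp: traces_def box_family_def\<close>)
qed

lemma box_family_Union:
  assumes "box_family \<A>"
  shows "open (\<Union>\<A>)" "bounded (\<Union>\<A>)" "\<Union>\<A> \<in> fmeasurable lborel"
    "\<A> \<noteq> {} \<Longrightarrow> 0 < measure lborel (\<Union>\<A>)"
proof -
  show o: "open (\<Union>\<A>)" "bounded (\<Union>\<A>)"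
    using assms unfolding box_family_def by (auto intro!: open_Union bounded_Union)
  show f: "\<Union>\<A> \<in> fmeasurable lborel" by (intro open_bounded_fmeasurable o)
  show "0 < measure lborel (\<Union>\<A>)" if "\<A> \<noteq> {}"
    using that assms by (intro measure_lborel_open_pos f o) (auto simp: box_family_def)
qed

text \<open>By the intermediate value theorem a hyperplane of given direction can cut off any proportion of
  the volume.\<close>

lemma halfspace_proportion:
  fixes B :: "'a::euclidean_space set"
  assumes B: "open B" "bounded B" and i: "i \<noteq> 0" and \<alpha>: "0 \<le> \<alpha>" "\<alpha> \<le> 1"
  shows "\<exists>e. measure lborel (B \<inter> {y. i \<bullet> y < e}) = \<alpha> * measure lborel B"
proof -
  have fB: "B \<in> fmeasurable lborel" by (intro open_bounded_fmeasurable B)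
  obtain R where R: "\<And>y. y \<in> B \<Longrightarrow> norm y \<le> R" using B by (auto simp: bounded_iff)
  define S where "S = norm i * \<bar>R\<bar> + 1"
  have S: "\<bar>i \<bullet> y\<bar> < S" if "y \<in> B" for y
  proof -
    have "\<bar>i \<bullet> y\<bar> \<le> norm i * norm y" by (rule Cauchy_Schwarz_ineq2)
    also have "\<dots> \<le> norm i * \<bar>R\<bar>" using R[OF that] by (intro mult_left_mono) auto
    finally show ?thesis by (simp add: S_def)
  qed
  have lo: "B \<inter> {y. i \<bullet> y < - S} = {}" and hi: "B \<inter> {y. i \<bullet> y < S} = B"
    using S by (auto simp: abs_less_iff) (smt (verit))+
  have "\<exists>e. - S \<le> e \<and> e \<le> S \<and> measure lborel (B \<inter> {y. i \<bullet> y < e}) = \<alpha> * measure lborel B"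
  proof (rule IVT')
    show "continuous_on {- S..S} (\<lambda>e. measure lborel (B \<inter> {y. i \<bullet> y < e}))"
      using continuous_measure_halfspace[OF fB i] continuous_on_subset by blast
    show "- S \<le> S" by (simp add: S_def add_nonneg_nonneg)
  qed (use lo hi \<alpha> in \<open>auto simp: mult_left_le_one_le\<close>)
  then show ?thesis by blast
qed

lemma brunn_minkowski_boxes:
  fixes a b c d :: "'a::euclidean_space"
  assumes "box a b \<noteq> {}" "box c d \<noteq> {}"
  defines "n \<equiv> DIM('a)"
  shows "(root n (measure lborel (box a b)) + root n (measure lborel (box c d))) ^ n
    \<le> measure lborel (box a b + box c d)"
proof -
  have ab: "a \<bullet> i < b \<bullet> i" "c \<bullet> i < d \<bullet> i" if "i \<in> Basis" for i
    using assms that by (auto simp: box_ne_empty)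
  have m: "measure lborel (box a b) = (\<Prod>i\<in>Basis. (b - a) \<bullet> i)"
      "measure lborel (box c d) = (\<Prod>i\<in>Basis. (d - c) \<bullet> i)"
      "measure lborel (box (a + c) (b + d)) = (\<Prod>i\<in>Basis. (b - a) \<bullet> i + (d - c) \<bullet> i)"
    using ab by (auto simp: measure_lborel_box_eq less_imp_le add_mono inner_simps algebra_simps
        intro!: prod.cong)
  have sub: "box (a + c) (b + d) \<subseteq> box a b + box c d"
  proof
    fix z assume z: "z \<in> box (a + c) (b + d)"
    \<comment> \<open>In each coordinate \<open>z\<close> is split so that both parts have the same relative position in their edges.\<close>
    define \<theta> where "\<theta> i = (z \<bullet> i - (a + c) \<bullet> i) / ((b + d) \<bullet> i - (a + c) \<bullet> i)" for i
    define x where "x = (\<Sum>i\<in>Basis. (a \<bullet> i + \<theta> i * (b \<bullet> i - a \<bullet> i)) *\<^sub>R i)"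
    have \<theta>: "0 < \<theta> i" "\<theta> i < 1" "z \<bullet> i = (a + c) \<bullet> i + \<theta> i * ((b + d) \<bullet> i - (a + c) \<bullet> i)"
      if "i \<in> Basis" for i
    proof -
      have "(a + c) \<bullet> i < z \<bullet> i" "z \<bullet> i < (b + d) \<bullet> i" using z that by (auto simp: mem_box)
      then show "0 < \<theta> i" "\<theta> i < 1" "z \<bullet> i = (a + c) \<bullet> i + \<theta> i * ((b + d) \<bullet> i - (a + c) \<bullet> i)"
        by (auto simp: \<theta>_def)
    qed
    have conv: "u < u + t * (v - u)" "u + t * (v - u) < v" if "0 < t" "t < 1" "u < v" for t u v :: real
    proof -
      have "0 < t * (v - u)" "0 < (1 - t) * (v - u)" using that by auto
      then show "u < u + t * (v - u)" "u + t * (v - u) < v" by (auto simp: algebra_simps)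
    qed
    have xi: "x \<bullet> i = a \<bullet> i + \<theta> i * (b \<bullet> i - a \<bullet> i)" if "i \<in> Basis" for i
      using that by (simp add: x_def)
    have "x \<in> box a b"
      using \<theta> ab conv xi by (auto simp: mem_box)
    moreover have "z - x \<in> box c d"
    proof -
      have "(z - x) \<bullet> i = c \<bullet> i + \<theta> i * (d \<bullet> i - c \<bullet> i)" if "i \<in> Basis" for i
        using \<theta>(3)[OF that] xi[OF that] by (simp add: inner_simps algebra_simps)
      then show ?thesis using \<theta> ab conv by (auto simp: mem_box)
    qed
    ultimately have "x + (z - x) \<in> box a b + box c d" by (rule set_plus_intro)
    then show "z \<in> box a b + box c d" by simp
  qed
  have "(root n (measure lborel (box a b)) + root n (measure lborel (box c d))) ^ n
    \<le> measure lborel (box (a + c) (b + d))"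
    unfolding m n_def by (intro root_prod_add_le) (use ab in \<open>auto simp: inner_simps\<close>)
  also have "\<dots> \<le> measure lborel (box a b + box c d)"
    by (intro measure_mono_fmeasurable sub open_bounded_fmeasurable open_set_plus bounded_set_plus) auto
  finally show ?thesis .
qed

text \<open>The step of the Hadwiger--Ohmann induction: two boxes of \<open>\<A>\<close> are separated by a coordinate
  hyperplane, and \<open>\<B>\<close> is cut by a parallel one in the same proportion. For equal proportions the
  two inequalities of the parts add up to the inequality of the whole.\<close>

lemma brunn_minkowski_cut:
  fixes \<A> \<B> :: "'a::euclidean_space set set"
  assumes \<A>: "box_family \<A>" "2 \<le> card \<A>" and \<B>: "box_family \<B>" "\<B> \<noteq> {}"
  assumes IH: "\<And>\<A>' \<B>' :: 'a set set. box_family \<A>' \<Longrightarrow> \<A>' \<noteq> {} \<Longrightarrow> box_family \<B>' \<Longrightarrow> \<B>' \<noteq> {} \<Longrightarrow>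
      card \<A>' + card \<B>' < card \<A> + card \<B> \<Longrightarrow>
      (root DIM('a) (measure lborel (\<Union>\<A>')) + root DIM('a) (measure lborel (\<Union>\<B>'))) ^ DIM('a)
        \<le> measure lborel (\<Union>\<A>' + \<Union>\<B>')"
  shows "(root DIM('a) (measure lborel (\<Union>\<A>)) + root DIM('a) (measure lborel (\<Union>\<B>))) ^ DIM('a)
    \<le> measure lborel (\<Union>\<A> + \<Union>\<B>)"
proof -
  let ?n = "DIM('a)" and ?A = "\<Union>\<A>" and ?B = "\<Union>\<B>" and ?m = "measure lborel :: 'a set \<Rightarrow> real"
  have fin: "finite \<A>" "finite \<B>" using \<A> \<B> by (auto simp: box_family_def)
  obtain X Y where XY: "X \<in> \<A>" "Y \<in> \<A>" "X \<noteq> Y"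
    using \<A>(2) by (metis One_nat_def Suc_1 card_le_Suc0_iff_eq fin(1) not_less_eq_eq)
  then have "X \<inter> Y = {}" using \<A> by (auto simp: box_family_def pairwise_def disjnt_def)
  moreover obtain a b c d where box: "X = box a b" "Y = box c d" "X \<noteq> {}" "Y \<noteq> {}"
    using XY \<A> unfolding box_family_def by metis
  ultimately obtain i where i: "i \<in> Basis" "b \<bullet> i \<le> c \<bullet> i \<or> d \<bullet> i \<le> a \<bullet> i"
    using disjoint_interval(4)[of a b c d] by (metis box_ne_empty(2) not_le)
  obtain X' Y' \<gamma> where X': "X' \<in> \<A>" "Y' \<in> \<A>" "X' \<noteq> {}" "Y' \<noteq> {}"
      "X' \<inter> {y. \<gamma> < i \<bullet> y} = {}" "Y' \<inter> {y. i \<bullet> y < \<gamma>} = {}"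
      "X' \<subseteq> {y. i \<bullet> y < \<gamma>}" "Y' \<subseteq> {y. \<gamma> < i \<bullet> y}"
  proof (cases "b \<bullet> i \<le> c \<bullet> i")
    case True
    have "i \<bullet> y < b \<bullet> i" if "y \<in> X" for y
      using that i(1) unfolding box inner_commute[of i y] by (simp add: mem_box)
    moreover have "b \<bullet> i < i \<bullet> y" if "y \<in> Y" for y
      using that i(1) True unfolding box inner_commute[of i y] by (auto simp: mem_box intro: le_less_trans)
    ultimately show thesis
      by (intro that[of X Y "b \<bullet> i"] XY box(3,4)) (auto dest: less_asym)
  next
    case False
    then have "d \<bullet> i \<le> a \<bullet> i" using i by simp
    have "i \<bullet> y < d \<bullet> i" if "y \<in> Y" for y
      using that i(1) unfolding box inner_commute[of i y] by (simp add: mem_box)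
    moreover have "d \<bullet> i < i \<bullet> y" if "y \<in> X" for y
      using that i(1) \<open>d \<bullet> i \<le> a \<bullet> i\<close> unfolding box inner_commute[of i y]
      by (auto simp: mem_box intro: le_less_trans)
    ultimately show thesis
      by (intro that[of Y X "d \<bullet> i"] XY box(3,4)) (auto dest: less_asym)
  qed
  define lo hi where "lo = (\<lambda>c. {y. i \<bullet> y < c})" and "hi = (\<lambda>c. {y. c < i \<bullet> y})"
  have i0: "i \<noteq> 0" using i(1) by auto
  note A = box_family_Union[OF \<A>(1)] and B = box_family_Union[OF \<B>(1)]
  have ne: "\<A> \<noteq> {}" using XY by auto
  define \<alpha> where "\<alpha> = ?m (?A \<inter> lo \<gamma>) / ?m ?A"
  have ops: "open (lo \<gamma>)" "open (hi \<gamma>)"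
    by (auto simp: lo_def hi_def open_halfspace_lt open_halfspace_gt)
  have sub: "X' \<subseteq> ?A \<inter> lo \<gamma>" "Y' \<subseteq> ?A \<inter> hi \<gamma>" using X' by (auto simp: lo_def hi_def)
  have posA: "0 < ?m (?A \<inter> lo \<gamma>)" "0 < ?m (?A \<inter> hi \<gamma>)" "0 < ?m ?A" "0 < ?m ?B"
    using A B ne X' \<B>(2) ops sub
    by (auto intro!: measure_lborel_open_pos open_bounded_fmeasurable open_Int bounded_Int)
  have splitA: "?m ?A = ?m (?A \<inter> lo \<gamma>) + ?m (?A \<inter> hi \<gamma>)"
    unfolding lo_def hi_def by (rule measure_split_halfspaces[OF A(3) i0])
  have \<alpha>: "0 < \<alpha>" "\<alpha> < 1" using posA splitA by (auto simp: \<alpha>_def)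
  obtain e where e: "?m (?B \<inter> lo e) = \<alpha> * ?m ?B"
    using halfspace_proportion[OF B(1,2) i0, of \<alpha>] \<alpha> by (auto simp: lo_def)
  have splitB: "?m ?B = ?m (?B \<inter> lo e) + ?m (?B \<inter> hi e)"
    unfolding lo_def hi_def by (rule measure_split_halfspaces[OF B(3) i0])
  have vol: "?m (?A \<inter> lo \<gamma>) = \<alpha> * ?m ?A" using posA(3) by (simp add: \<alpha>_def)
  with splitA splitB e have vol': "?m (?A \<inter> hi \<gamma>) = (1 - \<alpha>) * ?m ?A" "?m (?B \<inter> hi e) = (1 - \<alpha>) * ?m ?B"
    by (simp_all add: left_diff_distrib)
  have part: "\<beta> * (root ?n (?m ?A) + root ?n (?m ?B)) ^ ?n \<le> ?m (?A \<inter> H + ?B \<inter> H')"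
    if H: "?m (?A \<inter> H) = \<beta> * ?m ?A" "?m (?B \<inter> H') = \<beta> * ?m ?B" "0 < \<beta>"
      "box_family (traces H \<A>)" "box_family (traces H' \<B>)" "card (traces H \<A>) < card \<A>"
    for \<beta> H H'
  proof -
    have "?A \<inter> H \<noteq> {}" "?B \<inter> H' \<noteq> {}" using H posA by (metis measure_empty less_irrefl zero_less_mult_iff)+
    then have "traces H \<A> \<noteq> {}" "traces H' \<B> \<noteq> {}" by (auto simp: traces_def)
    with H have "(root ?n (?m (?A \<inter> H)) + root ?n (?m (?B \<inter> H'))) ^ ?n \<le> ?m (?A \<inter> H + ?B \<inter> H')"
      using IH[of "traces H \<A>" "traces H' \<B>"] card_traces_le[OF fin(2), of H']
      by (simp add: Union_traces)
    moreover have "(root ?n (?m (?A \<inter> H)) + root ?n (?m (?B \<inter> H'))) ^ ?n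
        = (root ?n \<beta> * (root ?n (?m ?A) + root ?n (?m ?B))) ^ ?n"
      by (simp add: H(1,2) real_root_mult distrib_left)
    moreover have "\<dots> = \<beta> * (root ?n (?m ?A) + root ?n (?m ?B)) ^ ?n"
      using H(3) by (simp add: power_mult_distrib)
    ultimately show ?thesis by simp
  qed
  have "(root ?n (?m ?A) + root ?n (?m ?B)) ^ ?n
      = \<alpha> * (root ?n (?m ?A) + root ?n (?m ?B)) ^ ?n + (1 - \<alpha>) * (root ?n (?m ?A) + root ?n (?m ?B)) ^ ?n"
    by (simp add: algebra_simps)
  also have "\<dots> \<le> ?m (?A \<inter> lo \<gamma> + ?B \<inter> lo e) + ?m (?A \<inter> hi \<gamma> + ?B \<inter> hi e)"
  proof (intro add_mono part vol vol' e)
    show "box_family (traces (lo \<gamma>) \<A>)" "box_family (traces (lo e) \<B>)"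
        "box_family (traces (hi \<gamma>) \<A>)" "box_family (traces (hi e) \<B>)"
      unfolding lo_def hi_def by (intro box_family_traces \<A> \<B> i)+
    show "card (traces (lo \<gamma>) \<A>) < card \<A>" "card (traces (hi \<gamma>) \<A>) < card \<A>"
      unfolding lo_def hi_def
      by (rule card_traces_less[OF fin(1) X'(2) X'(6)], rule card_traces_less[OF fin(1) X'(1) X'(5)])
  qed (use \<alpha> in auto)
  also have "\<dots> \<le> ?m (?A + ?B)"
    unfolding lo_def hi_def by (intro measure_set_plus_halfspaces A B)
  finally show ?thesis .
qed

lemma brunn_minkowski_box_families:
  fixes \<A> \<B> :: "'a::euclidean_space set set"
  assumes "box_family \<A>" "\<A> \<noteq> {}" "box_family \<B>" "\<B> \<noteq> {}"
  shows "(root DIM('a) (measure lborel (\<Union>\<A>)) + root DIM('a) (measure lborel (\<Union>\<B>))) ^ DIM('a)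
    \<le> measure lborel (\<Union>\<A> + \<Union>\<B>)"
  using assms
proof (induction "card \<A> + card \<B>" arbitrary: \<A> \<B> rule: less_induct)
  case less
  have fin: "0 < card \<A>" "0 < card \<B>" using less.prems by (auto simp: box_family_def card_gt_0_iff)
  consider "2 \<le> card \<A>" | "2 \<le> card \<B>" | "card \<A> = 1" "card \<B> = 1" using fin by linarith
  then show ?case
  proof cases
    case 1
    show ?thesis
      by (rule brunn_minkowski_cut[OF less.prems(1) 1 less.prems(3,4)]) (rule less.hyps)
  next
    case 2
    have "(root DIM('a) (measure lborel (\<Union>\<B>)) + root DIM('a) (measure lborel (\<Union>\<A>))) ^ DIM('a)
        \<le> measure lborel (\<Union>\<B> + \<Union>\<A>)"
    proof (rule brunn_minkowski_cut[OF less.prems(3) 2 less.prems(1,2)])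
      fix \<A>' \<B>' :: "'a set set"
      assume "box_family \<A>'" "\<A>' \<noteq> {}" "box_family \<B>'" "\<B>' \<noteq> {}" "card \<A>' + card \<B>' < card \<B> + card \<A>"
      then show "(root DIM('a) (measure lborel (\<Union>\<A>')) + root DIM('a) (measure lborel (\<Union>\<B>'))) ^ DIM('a)
        \<le> measure lborel (\<Union>\<A>' + \<Union>\<B>')"
        by (intro less.hyps) linarith+
    qed
    then show ?thesis by (simp only: add.commute[of "\<Union>\<B>" "\<Union>\<A>"] add.commute[of "root DIM('a) (measure lborel (\<Union>\<B>))"])
  next
    case 3
    then obtain X Y where XY: "\<A> = {X}" "\<B> = {Y}" by (auto simp: card_1_singleton_iff)
    with less.prems have "X \<noteq> {}" "Y \<noteq> {}" "\<exists>a b. X = box a b" "\<exists>a b. Y = box a b"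
      by (simp_all add: box_family_def)
    then obtain a b c d where eq: "X = box a b" "Y = box c d" by (elim exE)
    show ?thesis
      using brunn_minkowski_boxes[of a b c d] \<open>X \<noteq> {}\<close> \<open>Y \<noteq> {}\<close> by (simp add: XY eq)
  qed
qed

text \<open>An open set is a countable union of dyadic cubes with disjoint interiors. Passing to the interiors
  loses only a null set, and finitely many cubes already carry almost all of the volume.\<close>

lemma box_family_approximation:
  fixes A :: "'a::euclidean_space set"
  assumes A: "open A" "bounded A" "A \<noteq> {}" and \<epsilon>: "0 < \<epsilon>"
  obtains \<A> where "box_family \<A>" "\<A> \<noteq> {}" "\<Union>\<A> \<subseteq> A" "measure lborel A - \<epsilon> < measure lborel (\<Union>\<A>)"
proof -
  obtain a where a: "A \<subseteq> cbox (- a) a" using bounded_subset_cbox_symmetric[OF A(2)] by blast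
  then have "A \<subseteq> box (- a) a" using A(1) interior_maximal interior_cbox by metis
  then have ne: "box (- a) a \<noteq> {}" using A(3) by blast
  have g: "gauge (\<lambda>x. if x \<in> A then A else UNIV)" using A(1) by (auto simp: gauge_def)
  obtain \<D> where \<D>: "countable \<D>" "\<And>K. K \<in> \<D> \<Longrightarrow> interior K \<noteq> {} \<and> (\<exists>c d. K = cbox c d)"
      "pairwise (\<lambda>A B. interior A \<inter> interior B = {}) \<D>"
      "\<And>K. K \<in> \<D> \<Longrightarrow> \<exists>x\<in>A \<inter> K. K \<subseteq> (if x \<in> A then A else UNIV)" "A \<subseteq> \<Union>\<D>"
    by (rule covering_lemma[OF a ne g]) blast
  have sub: "K \<subseteq> A" if "K \<in> \<D>" for K using \<D>(4)[OF that] by auto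
  have "\<D> \<noteq> {}" using \<D>(5) A(3) by auto
  then obtain f :: "nat \<Rightarrow> 'a set" where f: "range f = \<D>"
    using \<D>(1) by (metis range_from_nat_into)
  define U where "U k = (\<Union>j\<le>k. interior (f j))" for k
  have fA: "A \<in> fmeasurable lborel" by (intro open_bounded_fmeasurable A)
  have [measurable]: "A \<in> sets borel" using A by simp
  have Uo: "open (U k)" for k by (auto simp: U_def)
  have Us: "(\<Union>k. U k) \<subseteq> A" using sub f interior_subset by (fastforce simp: U_def)
  have "(\<lambda>k. measure lborel (U k)) \<longlonglongrightarrow> measure lborel (\<Union>k. U k)"
  proof (rule Lim_measure_incseq)
    show "range U \<subseteq> sets lborel" using Uo by auto
    show "incseq U" unfolding U_def incseq_def by (intro allI impI UN_mono) auto
    show "emeasure lborel (\<Union>k. U k) \<noteq> \<infinity>"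
      using Us fA emeasure_mono[of "\<Union>k. U k" A lborel] by (auto simp: fmeasurable_def top_unique)
  qed
  also have "measure lborel (\<Union>k. U k) = measure lborel A"
  proof (rule measure_eq_AE)
    have "f j - interior (f j) \<in> null_sets lborel" for j
    proof -
      obtain c d where "f j = cbox c d" using \<D>(2) f by blast
      then show ?thesis
        using negligible_frontier_interval[of c d] by (auto intro!: negligible_imp_null_lborel)
    qed
    then have "AE y in lborel. \<forall>j. y \<notin> f j - interior (f j)"
      unfolding AE_all_countable by (intro allI AE_not_in)
    then show "AE y in lborel. y \<in> (\<Union>k. U k) \<longleftrightarrow> y \<in> A"
    proof (rule AE_mp, intro AE_I2 impI)
      fix y assume y: "\<forall>j. y \<notin> f j - interior (f j)"
      show "y \<in> (\<Union>k. U k) \<longleftrightarrow> y \<in> A"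
      proof
        assume "y \<in> A"
        then obtain j where "y \<in> f j" using \<D>(5) f by blast
        with y have "y \<in> U j" by (auto simp: U_def)
        then show "y \<in> (\<Union>k. U k)" by blast
      qed (use Us in auto)
    qed
  qed (use Uo in auto)
  finally have "\<forall>\<^sub>F k in sequentially. measure lborel A - \<epsilon> < measure lborel (U k)"
    by (rule order_tendstoD) (use \<epsilon> in simp)
  then obtain k where k: "measure lborel A - \<epsilon> < measure lborel (U k)"
    by (metis eventually_sequentially order_refl)
  define \<A> where "\<A> = (\<lambda>j. interior (f j)) ` {..k}"
  have "interior (f j) \<noteq> {} \<and> (\<exists>c d. interior (f j) = box c d)" for j
    using \<D>(2)[of "f j"] f by (metis interior_cbox rangeI)
  moreover have "disjoint \<A>"
    unfolding pairwise_def disjnt_def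
  proof (intro ballI impI)
    fix X Y assume "X \<in> \<A>" "Y \<in> \<A>" "X \<noteq> Y"
    then obtain i j where ij: "X = interior (f i)" "Y = interior (f j)" unfolding \<A>_def by blast
    with \<open>X \<noteq> Y\<close> have "f i \<noteq> f j" by auto
    with ij show "X \<inter> Y = {}" using pairwiseD[OF \<D>(3), of "f i" "f j"] f by auto
  qed
  ultimately have "box_family \<A>" by (auto simp: box_family_def \<A>_def)
  moreover have "\<Union>\<A> = U k" by (auto simp: \<A>_def U_def)
  ultimately show thesis using k Us by (intro that[of \<A>]) (auto simp: \<A>_def)
qed

lemma brunn_minkowski_open:
  fixes A B :: "'a::euclidean_space set"
  assumes A: "open A" "bounded A" "A \<noteq> {}" and B: "open B" "bounded B" "B \<noteq> {}"
  shows "(root DIM('a) (measure lborel A) + root DIM('a) (measure lborel B)) ^ DIM('a) \<le> measure lborel (A + B)"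
proof -
  let ?n = "DIM('a)" and ?m = "measure lborel :: 'a set \<Rightarrow> real"
  define \<F> where "\<F> S k = (SOME \<A>. box_family \<A> \<and> \<A> \<noteq> {} \<and> \<Union>\<A> \<subseteq> S \<and>
      ?m S - inverse (real (Suc k)) < ?m (\<Union>\<A>))" for S k
  have \<F>: "box_family (\<F> S k)" "\<F> S k \<noteq> {}" "\<Union>(\<F> S k) \<subseteq> S"
      "?m S - inverse (real (Suc k)) < ?m (\<Union>(\<F> S k))"
    if S: "open S" "bounded S" "S \<noteq> {}" for k S
  proof -
    have pos: "0 < inverse (real (Suc k))" by simp
    obtain \<A> where "box_family \<A>" "\<A> \<noteq> {}" "\<Union>\<A> \<subseteq> S" "?m S - inverse (real (Suc k)) < ?m (\<Union>\<A>)"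
      by (rule box_family_approximation[OF S pos])
    then have "\<exists>\<A>. box_family \<A> \<and> \<A> \<noteq> {} \<and> \<Union>\<A> \<subseteq> S \<and> ?m S - inverse (real (Suc k)) < ?m (\<Union>\<A>)"
      by blast
    from someI_ex[OF this] show "box_family (\<F> S k)" "\<F> S k \<noteq> {}" "\<Union>(\<F> S k) \<subseteq> S"
      "?m S - inverse (real (Suc k)) < ?m (\<Union>(\<F> S k))"
      unfolding \<F>_def by simp_all
  qed
  have lim: "(\<lambda>k. ?m (\<Union>(\<F> S k))) \<longlonglongrightarrow> ?m S" if S: "open S" "bounded S" "S \<noteq> {}" for S
  proof (rule tendsto_sandwich)
    show "(\<lambda>k. ?m S - inverse (real (Suc k))) \<longlonglongrightarrow> ?m S"
      using tendsto_diff[OF tendsto_const LIMSEQ_inverse_real_of_nat, of "?m S"] by simp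
    show "\<forall>\<^sub>F k in sequentially. ?m (\<Union>(\<F> S k)) \<le> ?m S"
      using \<F>[OF S] box_family_Union(3)[OF \<F>(1)[OF S]] open_bounded_fmeasurable[OF S(1,2)]
      by (intro always_eventually allI measure_mono_fmeasurable) (auto simp: fmeasurable_def)
  qed (use \<F>(4)[OF S] in \<open>auto intro!: always_eventually less_imp_le\<close>)
  show ?thesis
  proof (rule LIMSEQ_le_const2)
    show "(\<lambda>k. (root ?n (?m (\<Union>(\<F> A k))) + root ?n (?m (\<Union>(\<F> B k)))) ^ ?n)
        \<longlonglongrightarrow> (root ?n (?m A) + root ?n (?m B)) ^ ?n"
      by (intro tendsto_intros lim A B)
    have "(root ?n (?m (\<Union>(\<F> A k))) + root ?n (?m (\<Union>(\<F> B k)))) ^ ?n \<le> ?m (A + B)" for k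
    proof -
      note FA = \<F>[OF A, of k] and FB = \<F>[OF B, of k]
      have "(root ?n (?m (\<Union>(\<F> A k))) + root ?n (?m (\<Union>(\<F> B k)))) ^ ?n \<le> ?m (\<Union>(\<F> A k) + \<Union>(\<F> B k))"
        by (intro brunn_minkowski_box_families FA FB)
      also have "\<dots> \<le> ?m (A + B)"
      proof (rule measure_mono_fmeasurable)
        show "\<Union>(\<F> A k) + \<Union>(\<F> B k) \<subseteq> A + B" by (intro set_plus_mono2 FA FB)
        show "\<Union>(\<F> A k) + \<Union>(\<F> B k) \<in> sets lborel"
          using open_set_plus[OF box_family_Union(1)[OF FA(1)] box_family_Union(1)[OF FB(1)]] by simp
        show "A + B \<in> fmeasurable lborel"
          by (intro open_bounded_fmeasurable open_set_plus bounded_set_plus A B)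
      qed
      finally show ?thesis .
    qed
    then show "\<exists>N. \<forall>k\<ge>N. (root ?n (?m (\<Union>(\<F> A k))) + root ?n (?m (\<Union>(\<F> B k)))) ^ ?n \<le> ?m (A + B)"
      by blast
  qed
qed

lemma compact_fmeasurable:
  fixes A :: "'a::euclidean_space set"
  assumes "compact A" shows "A \<in> fmeasurable lborel"
  using assms emeasure_bounded_finite[of A] compact_imp_bounded borel_compact by (auto simp: fmeasurable_def)

lemma measure_lborel_scale:
  fixes A :: "'a::euclidean_space set"
  assumes "compact A" shows "measure lborel ((\<lambda>y. c *\<^sub>R y + d) ` A) = \<bar>c\<bar> ^ DIM('a) * measure lborel A"
proof -
  have "compact ((\<lambda>y. c *\<^sub>R y + d) ` A)"
    using assms by (intro compact_continuous_image continuous_intros)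
  then show ?thesis
    using measure_lebesgue_affine[of c d A] assms by (simp add: borel_compact)
qed

text \<open>The degenerate case: if one summand has no volume, the sum still contains a translate of the other.\<close>

lemma brunn_minkowski_point:
  fixes A C :: "'a::euclidean_space set"
  assumes "compact A" "compact C" "b \<in> B" "A + B \<subseteq> C"
  shows "measure lborel A \<le> measure lborel C"
proof -
  have "measure lborel A = measure lborel ((\<lambda>y. 1 *\<^sub>R y + b) ` A)"
    using measure_lborel_scale[OF assms(1), of 1 b] by simp
  also have "\<dots> \<le> measure lborel C"
  proof (rule measure_mono_fmeasurable)
    show "(\<lambda>y. 1 *\<^sub>R y + b) ` A \<subseteq> C" using assms(3,4) by (auto simp: set_plus_def)
    have "compact ((\<lambda>y. 1 *\<^sub>R y + b) ` A)"
      using assms by (intro compact_continuous_image continuous_intros)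
    then show "(\<lambda>y. 1 *\<^sub>R y + b) ` A \<in> sets lborel" by (simp add: borel_compact)
  qed (intro compact_fmeasurable assms)
  finally show ?thesis .
qed

lemma measure_interior_convex:
  fixes A :: "'a::euclidean_space set"
  assumes "compact A" "convex A" shows "measure lborel (interior A) = measure lborel A"
proof (rule measure_eq_AE)
  have "AE y in lborel. y \<notin> frontier A"
    using negligible_convex_frontier[OF assms(2)] by (intro AE_not_in negligible_imp_null_lborel) auto
  then show "AE y in lborel. y \<in> interior A \<longleftrightarrow> y \<in> A"
    by (rule AE_mp) (use assms in \<open>auto simp: frontier_def compact_imp_closed intro!: AE_I2 dest: interior_subset[THEN subsetD]\<close>)
qed (use assms in \<open>auto simp: borel_compact\<close>)

text \<open>A compact convex set is either flat, which is the degenerate case, or differs from its interior by a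
  null set. The superset \<open>C\<close> of the sum is convenient for caps of a convex body, where the sum of two
  scaled caps is merely contained in another cap.\<close>

theorem brunn_minkowski_convex:
  fixes A B C :: "'a::euclidean_space set"
  assumes A: "compact A" "convex A" "A \<noteq> {}" and B: "compact B" "convex B" "B \<noteq> {}"
    and C: "compact C" "A + B \<subseteq> C"
  shows "(root DIM('a) (measure lborel A) + root DIM('a) (measure lborel B)) ^ DIM('a) \<le> measure lborel C"
proof -
  have thin: "measure lborel S = 0" if "interior S = {}" "compact S" "convex S" for S :: "'a set"
    using measure_interior_convex[OF that(2,3)] that(1) by simp
  consider "interior A = {}" | "interior B = {}" | "interior A \<noteq> {}" "interior B \<noteq> {}" by blast
  then show ?thesis
  proof cases
    case 1
    obtain a where "a \<in> A" using A by blast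
    then have "measure lborel B \<le> measure lborel C"
      using C by (intro brunn_minkowski_point[OF B(1) C(1)]) (auto simp: add.commute[of B A])
    then show ?thesis using thin[OF 1 A(1,2)] by simp
  next
    case 2
    obtain b where "b \<in> B" using B by blast
    then have "measure lborel A \<le> measure lborel C"
      using C by (intro brunn_minkowski_point[OF A(1) C(1)])
    then show ?thesis using thin[OF 2 B(1,2)] by simp
  next
    case 3
    have "(root DIM('a) (measure lborel (interior A)) + root DIM('a) (measure lborel (interior B))) ^ DIM('a)
        \<le> measure lborel (interior A + interior B)"
      using 3 A B by (intro brunn_minkowski_open) (auto intro: bounded_interior compact_imp_bounded)
    also have "\<dots> \<le> measure lborel C"
    proof (rule measure_mono_fmeasurable)
      have "interior A + interior B \<subseteq> A + B" by (intro set_plus_mono2 interior_subset)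
      then show "interior A + interior B \<subseteq> C" using C by blast
    qed (use open_set_plus[of "interior A" "interior B"] C in \<open>auto intro: compact_fmeasurable\<close>)
    finally show ?thesis using A B by (simp add: measure_interior_convex)
  qed
qed

section \<open>The volume of a polar body as an integral over the central polar body\<close>

lemma nn_integral_dilation:
  fixes f :: "'a::euclidean_space \<Rightarrow> ennreal"
  assumes [measurable]: "f \<in> borel_measurable borel" and c: "c \<noteq> 0"
  shows "(\<integral>\<^sup>+y. f y \<partial>lborel) = ennreal (\<bar>c\<bar> ^ DIM('a)) * (\<integral>\<^sup>+y. f (c *\<^sub>R y) \<partial>lborel)"
  by (subst lborel_affine[OF c, of 0])
    (simp add: nn_integral_density nn_integral_distr nn_integral_cmult)

lemma nn_integral_uminus:
  fixes f :: "'a::euclidean_space \<Rightarrow> ennreal"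
  assumes "f \<in> borel_measurable borel"
  shows "(\<integral>\<^sup>+y. f (- y) \<partial>lborel) = (\<integral>\<^sup>+y. f y \<partial>lborel)"
  using nn_integral_dilation[OF assms, of "-1"] by simp

lemma nn_integral_power_times_exp:
  fixes c :: real
  assumes c: "0 < c"
  shows "(\<integral>\<^sup>+u. ennreal (u ^ k * exp (- (c * u))) * indicator {0..} u \<partial>lborel) = ennreal (fact k / c ^ Suc k)"
proof -
  have "ennreal (fact k) = (\<integral>\<^sup>+u. ennreal (u ^ k * exp (- u)) * indicator {0..} u \<partial>lborel)"
    by (subst nn_intergal_power_times_exp_Ici) simp
  also have "\<dots> = ennreal c * (\<integral>\<^sup>+u. ennreal ((c * u) ^ k * exp (- (c * u))) * indicator {0..} (c * u) \<partial>lborel)"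
    using c by (subst nn_integral_real_affine[of _ c 0]) auto
  also have "\<dots> = ennreal c * (\<integral>\<^sup>+u. ennreal (c ^ k) * (ennreal (u ^ k * exp (- (c * u))) * indicator {0..} u) \<partial>lborel)"
  proof -
    have "ennreal ((c * u) ^ k * exp (- (c * u))) * indicator {0..} (c * u)
        = ennreal (c ^ k) * (ennreal (u ^ k * exp (- (c * u))) * indicator {0..} u)" for u
    proof (cases "0 \<le> u")
      case True
      then have "ennreal ((c * u) ^ k * exp (- (c * u))) = ennreal (c ^ k) * ennreal (u ^ k * exp (- (c * u)))"
        using c by (subst ennreal_mult[symmetric]) (auto simp: power_mult_distrib mult.assoc)
      then show ?thesis using True c by simp
    qed (use c in \<open>simp add: zero_le_mult_iff\<close>)
    then show ?thesis by simp
  qed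
  also have "\<dots> = ennreal (c ^ Suc k) * (\<integral>\<^sup>+u. ennreal (u ^ k * exp (- (c * u))) * indicator {0..} u \<partial>lborel)"
    using c by (simp add: nn_integral_cmult ennreal_mult mult.assoc)
  finally have "ennreal (1 / c ^ Suc k) * ennreal (fact k)
      = ennreal (1 / c ^ Suc k) * ennreal (c ^ Suc k) * (\<integral>\<^sup>+u. ennreal (u ^ k * exp (- (c * u))) * indicator {0..} u \<partial>lborel)"
    by (simp only: mult.assoc)
  moreover have "ennreal (1 / c ^ Suc k) * ennreal (c ^ Suc k) = 1"
    using c by (simp flip: ennreal_mult del: power_Suc)
  moreover have "ennreal (1 / c ^ Suc k) * ennreal (fact k) = ennreal (fact k / c ^ Suc k)"
    using c by (simp flip: ennreal_mult)
  ultimately show ?thesis by simp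
qed

text \<open>This is Fubini's theorem after writing \<open>exp (- g y)\<close> as the integral of \<open>exp (- u)\<close> over \<open>u \<ge> g y\<close>: the
  sublevel set \<open>{g \<le> u}\<close> is the dilate by \<open>u\<close> of \<open>{g \<le> 1}\<close>, which produces the factor \<open>u\<^sup>n\<close>. For \<open>W = 1\<close>
  it states that \<open>\<integral> exp (- g)\<close> is \<open>n!\<close> times the volume of \<open>{g \<le> 1}\<close>, infinite values included.\<close>

lemma nn_integral_exp_homogeneous:
  fixes g :: "'a::euclidean_space \<Rightarrow> real" and W :: "'a \<Rightarrow> ennreal"
  assumes [measurable]: "g \<in> borel_measurable borel" "W \<in> borel_measurable borel"
  assumes hom: "\<And>u y. 0 < u \<Longrightarrow> g (u *\<^sub>R y) = u * g y" and nonneg: "\<And>y. 0 \<le> g y"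
  shows "(\<integral>\<^sup>+y. ennreal (exp (- g y)) * W y \<partial>lborel)
    = (\<integral>\<^sup>+u. indicator {0<..} u * ennreal (u ^ DIM('a) * exp (- u)) *
         (\<integral>\<^sup>+z. indicator {z. g z \<le> 1} z * W (u *\<^sub>R z) \<partial>lborel) \<partial>lborel)"
proof -
  have [measurable]: "{z. g z \<le> 1} \<in> sets borel" by measurable
  have exp_tail: "ennreal (exp (- a)) = (\<integral>\<^sup>+u. indicator {0<..} u * (ennreal (exp (- u)) * indicator {a..} u) \<partial>lborel)"
    if "0 \<le> a" for a :: real
  proof -
    have lim: "((\<lambda>u::real. - exp (- u)) \<longlongrightarrow> - 0) at_top"
      by (intro tendsto_minus filterlim_compose[OF exp_at_bot] filterlim_uminus_at_bot_at_top)
    have "(\<integral>\<^sup>+u. ennreal (exp (- u)) * indicator {a..} u \<partial>lborel) = ennreal (- 0 - (- exp (- a)))"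
      by (rule nn_integral_FTC_atLeast[OF _ _ _ lim]) (auto intro!: derivative_eq_intros)
    then have "ennreal (exp (- a)) = (\<integral>\<^sup>+u. ennreal (exp (- u)) * indicator {a..} u \<partial>lborel)" by simp
    also have "\<dots> = (\<integral>\<^sup>+u. indicator {0<..} u * (ennreal (exp (- u)) * indicator {a..} u) \<partial>lborel)"
    proof (rule nn_integral_cong_AE)
      show "AE u in lborel. ennreal (exp (- u)) * indicator {a..} u
          = indicator {0<..} u * (ennreal (exp (- u)) * indicator {a..} u)"
        using AE_lborel_singleton[of "0::real"] by eventually_elim (use that in \<open>auto simp: indicator_def\<close>)
    qed
    finally show ?thesis .
  qed
  have "(\<integral>\<^sup>+y. ennreal (exp (- g y)) * W y \<partial>lborel)
      = (\<integral>\<^sup>+y. (\<integral>\<^sup>+u. indicator {0<..} u * (ennreal (exp (- u)) * indicator {g y..} u) * W y \<partial>lborel) \<partial>lborel)"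
    by (intro nn_integral_cong) (simp add: exp_tail[OF nonneg] nn_integral_multc)
  also have "\<dots> = (\<integral>\<^sup>+y. (\<integral>\<^sup>+u. indicator {0<..} u * (ennreal (exp (- u)) * indicator {v. g y \<le> v} u) * W y \<partial>lborel) \<partial>lborel)"
    by (simp add: atLeast_def)
  also have "\<dots> = (\<integral>\<^sup>+u. (\<integral>\<^sup>+y. indicator {0<..} u * (ennreal (exp (- u)) * indicator {v. g y \<le> v} u) * W y \<partial>lborel) \<partial>lborel)"
    by (rule lborel_pair.Fubini') measurable
  also have "\<dots> = (\<integral>\<^sup>+u. indicator {0<..} u * ennreal (u ^ DIM('a) * exp (- u)) *
         (\<integral>\<^sup>+z. indicator {z. g z \<le> 1} z * W (u *\<^sub>R z) \<partial>lborel) \<partial>lborel)"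
  proof (rule nn_integral_cong)
    fix u :: real
    show "(\<integral>\<^sup>+y. indicator {0<..} u * (ennreal (exp (- u)) * indicator {v. g y \<le> v} u) * W y \<partial>lborel)
      = indicator {0<..} u * ennreal (u ^ DIM('a) * exp (- u)) *
         (\<integral>\<^sup>+z. indicator {z. g z \<le> 1} z * W (u *\<^sub>R z) \<partial>lborel)"
    proof (cases "0 < u")
      case True
      have "(\<integral>\<^sup>+y. indicator {0<..} u * (ennreal (exp (- u)) * indicator {v. g y \<le> v} u) * W y \<partial>lborel)
          = (\<integral>\<^sup>+y. ennreal (exp (- u)) * (indicator {y. g y \<le> u} y * W y) \<partial>lborel)"
        using True by (intro nn_integral_cong) (auto simp: indicator_def)
      also have "\<dots> = ennreal (exp (- u)) * (\<integral>\<^sup>+y. indicator {y. g y \<le> u} y * W y \<partial>lborel)"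
        by (rule nn_integral_cmult) measurable
      also have "(\<integral>\<^sup>+y. indicator {y. g y \<le> u} y * W y \<partial>lborel)
          = ennreal (u ^ DIM('a)) * (\<integral>\<^sup>+z. indicator {y. g y \<le> u} (u *\<^sub>R z) * W (u *\<^sub>R z) \<partial>lborel)"
        using True by (subst nn_integral_dilation[of _ u]) auto
      also have "(\<lambda>z. indicator {y. g y \<le> u} (u *\<^sub>R z) * W (u *\<^sub>R z)) = (\<lambda>z. indicator {z. g z \<le> 1} z * W (u *\<^sub>R z))"
        using True by (auto simp: fun_eq_iff indicator_def hom)
      finally show ?thesis
        using True by (simp add: ennreal_mult mult_ac)
    qed simp
  qed
  finally show ?thesis .
qed

text \<open>For a body containing the origin this is the gauge of the polar body, and \<open>support_fun K y - x \<bullet> y\<close> is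
  the gauge of the polar body with respect to \<open>x\<close>.\<close>

definition support_fun :: "'a::euclidean_space set \<Rightarrow> 'a \<Rightarrow> real" where
  "support_fun K y = (SUP z\<in>K. y \<bullet> z)"

lemma support_fun_le_iff:
  assumes "compact K" "K \<noteq> {}"
  shows "support_fun K y \<le> a \<longleftrightarrow> (\<forall>z\<in>K. y \<bullet> z \<le> a)"
proof -
  have "compact ((\<lambda>z. y \<bullet> z) ` K)" using assms by (intro compact_continuous_image continuous_intros)
  then have "bdd_above ((\<lambda>z. y \<bullet> z) ` K)" by (intro bounded_imp_bdd_above compact_imp_bounded)
  then show ?thesis unfolding support_fun_def by (subst cSUP_le_iff[OF assms(2)]) auto
qed

lemma support_fun_upper:
  assumes "compact K" "z \<in> K" shows "y \<bullet> z \<le> support_fun K y"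
  using support_fun_le_iff[of K y "support_fun K y"] assms by auto

lemma support_fun_scale:
  assumes K: "compact K" "K \<noteq> {}" and u: "0 < u"
  shows "support_fun K (u *\<^sub>R y) = u * support_fun K y"
proof (rule antisym)
  show "support_fun K (u *\<^sub>R y) \<le> u * support_fun K y"
    using u K by (auto simp: support_fun_le_iff intro: support_fun_upper)
  have "support_fun K y \<le> support_fun K (u *\<^sub>R y) / u"
    unfolding support_fun_le_iff[OF K]
    using u support_fun_upper[OF K(1), of _ "u *\<^sub>R y"] by (auto simp: pos_le_divide_eq mult.commute)
  then show "u * support_fun K y \<le> support_fun K (u *\<^sub>R y)" using u by (simp add: field_simps)
qed

lemma borel_measurable_support_fun:
  assumes "compact K" "K \<noteq> {}"
  shows "support_fun K \<in> borel_measurable borel"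
proof (rule borel_measurableI_le)
  fix a
  have "{y \<in> space borel. support_fun K y \<le> a} = (\<Inter>z\<in>K. {y. z \<bullet> y \<le> a})"
    using assms by (auto simp: support_fun_le_iff inner_commute)
  also have "closed \<dots>" by (intro closed_INT ballI closed_halfspace_le)
  finally show "{y \<in> space borel. support_fun K y \<le> a} \<in> sets borel" by simp
qed

lemma closed_polar_body: "closed (polar_body K x)"
proof -
  have "polar_body K x = (\<Inter>z\<in>K. {y. (z - x) \<bullet> y \<le> 1})" by (auto simp: polar_body_def inner_commute)
  also have "closed \<dots>" by (intro closed_INT ballI closed_halfspace_le)
  finally show ?thesis .
qed

text \<open>The integral of \<open>exp (- (h y - x \<bullet> y))\<close>, where \<open>h\<close> is the support function of \<open>K\<close>, is computed in two
  ways. On the one hand \<open>h y - x \<bullet> y\<close> is the gauge of \<open>polar_body K x\<close>, so the integral is \<open>n!\<close> times its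
  volume. On the other hand \<open>h\<close> is the gauge of \<open>L = polar_body K 0\<close> and \<open>exp (x \<bullet> y)\<close> is a weight, so it is
  the integral over \<open>z \<in> L\<close> of the Gamma integral \<open>\<integral> u\<^sup>n exp (- u (1 - x \<bullet> z)) du = n! / (1 - x \<bullet> z)\<^bsup>n+1\<^esup>\<close>.
  This only uses linear substitutions and holds up to the boundary of \<open>K\<close>, where both sides may be
  infinite. On the hyperplane \<open>x \<bullet> z = 1\<close> the quotient has the default value 0 instead of infinity, but
  this hyperplane is a null set.\<close>

theorem emeasure_polar_body:
  fixes K :: "'a::euclidean_space set"
  assumes K: "compact K" "0 \<in> K" and x: "x \<in> K"
  shows "emeasure lborel (polar_body K x)
    = (\<integral>\<^sup>+z. indicator (polar_body K 0) z * ennreal (1 / (1 - x \<bullet> z) ^ Suc DIM('a)) \<partial>lborel)"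
proof -
  let ?n = "DIM('a)" and ?h = "support_fun K" and ?L = "polar_body K 0"
  have ne: "K \<noteq> {}" using x by blast
  have [measurable]: "?h \<in> borel_measurable borel" by (intro borel_measurable_support_fun K ne)
  have [measurable]: "?L \<in> sets borel" "polar_body K x \<in> sets borel" by (simp_all add: closed_polar_body)
  have L: "{y. ?h y \<le> 1} = ?L"
    using K ne by (auto simp: support_fun_le_iff polar_body_def)
  have Kx: "{y. ?h y - x \<bullet> y \<le> 1} = polar_body K x"
    using K ne by (auto simp: support_fun_le_iff polar_body_def inner_diff_right inner_commute diff_le_eq)
  have le1: "x \<bullet> z \<le> 1" if "z \<in> ?L" for z using that x by (auto simp: polar_body_def inner_commute)
  define \<gamma> where "\<gamma> u = indicator {0<..} u * ennreal (u ^ ?n * exp (- u))" for u :: real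
  have [measurable]: "\<gamma> \<in> borel_measurable borel" unfolding \<gamma>_def by measurable
  have \<gamma>: "(\<integral>\<^sup>+u. \<gamma> u * ennreal (exp (u * s)) \<partial>lborel) = ennreal (fact ?n) * ennreal (1 / (1 - s) ^ Suc ?n)"
    if "s < 1" for s
  proof -
    have "(\<integral>\<^sup>+u. \<gamma> u * ennreal (exp (u * s)) \<partial>lborel)
        = (\<integral>\<^sup>+u. ennreal (u ^ ?n * exp (- ((1 - s) * u))) * indicator {0..} u \<partial>lborel)"
    proof (rule nn_integral_cong_AE)
      show "AE u in lborel. \<gamma> u * ennreal (exp (u * s)) = ennreal (u ^ ?n * exp (- ((1 - s) * u))) * indicator {0..} u"
        using AE_lborel_singleton[of "0::real"]
      proof eventually_elim
        fix u :: real assume "u \<noteq> 0"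
        then show "\<gamma> u * ennreal (exp (u * s)) = ennreal (u ^ ?n * exp (- ((1 - s) * u))) * indicator {0..} u"
          by (auto simp: \<gamma>_def indicator_def algebra_simps simp flip: ennreal_mult exp_add)
      qed
    qed
    also have "\<dots> = ennreal (fact ?n / (1 - s) ^ Suc ?n)" using that by (intro nn_integral_power_times_exp) simp
    also have "\<dots> = ennreal (fact ?n) * ennreal (1 / (1 - s) ^ Suc ?n)"
      using that by (subst ennreal_mult[symmetric]) auto
    finally show ?thesis .
  qed
  have "ennreal (fact ?n) * emeasure lborel (polar_body K x) = (\<integral>\<^sup>+u. \<gamma> u * emeasure lborel (polar_body K x) \<partial>lborel)"
    using \<gamma>[of 0] by (simp add: nn_integral_multc)
  also have "\<dots> = (\<integral>\<^sup>+y. ennreal (exp (- (?h y - x \<bullet> y))) * 1 \<partial>lborel)"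
  proof (subst nn_integral_exp_homogeneous)
    show "?h (u *\<^sub>R y) - x \<bullet> u *\<^sub>R y = u * (?h y - x \<bullet> y)" if "0 < u" for u y
      using support_fun_scale[OF K(1) ne that] by (simp add: algebra_simps)
    show "0 \<le> ?h y - x \<bullet> y" for y using support_fun_upper[OF K(1) x, of y] by (simp add: inner_commute)
  qed (simp_all add: Kx \<gamma>_def)
  also have "\<dots> = (\<integral>\<^sup>+y. ennreal (exp (- ?h y)) * ennreal (exp (x \<bullet> y)) \<partial>lborel)"
    by (intro nn_integral_cong) (simp flip: ennreal_mult exp_add)
  also have "\<dots> = (\<integral>\<^sup>+u. \<gamma> u * (\<integral>\<^sup>+z. indicator ?L z * ennreal (exp (u * (x \<bullet> z))) \<partial>lborel) \<partial>lborel)"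
  proof (subst nn_integral_exp_homogeneous)
    show "0 \<le> ?h y" for y using support_fun_upper[OF K, of y] by simp
  qed (use support_fun_scale[OF K(1) ne] in \<open>simp_all add: L \<gamma>_def\<close>)
  also have "\<dots> = (\<integral>\<^sup>+u. (\<integral>\<^sup>+z. indicator ?L z * (\<gamma> u * ennreal (exp (u * (x \<bullet> z)))) \<partial>lborel) \<partial>lborel)"
    by (subst nn_integral_cmult[symmetric]) (auto simp: mult_ac)
  also have "\<dots> = (\<integral>\<^sup>+z. (\<integral>\<^sup>+u. indicator ?L z * (\<gamma> u * ennreal (exp (u * (x \<bullet> z)))) \<partial>lborel) \<partial>lborel)"
    by (rule lborel_pair.Fubini') measurable
  also have "\<dots> = (\<integral>\<^sup>+z. ennreal (fact ?n) * (indicator ?L z * ennreal (1 / (1 - x \<bullet> z) ^ Suc ?n)) \<partial>lborel)"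
  proof (rule nn_integral_cong_AE)
    have "AE z in lborel. x \<bullet> z \<noteq> 1" by (rule AE_lborel_inner_neq) simp
    then show "AE z in lborel. (\<integral>\<^sup>+u. indicator ?L z * (\<gamma> u * ennreal (exp (u * (x \<bullet> z)))) \<partial>lborel)
      = ennreal (fact ?n) * (indicator ?L z * ennreal (1 / (1 - x \<bullet> z) ^ Suc ?n))"
    proof eventually_elim
      fix z assume z: "x \<bullet> z \<noteq> 1"
      show "(\<integral>\<^sup>+u. indicator ?L z * (\<gamma> u * ennreal (exp (u * (x \<bullet> z)))) \<partial>lborel)
        = ennreal (fact ?n) * (indicator ?L z * ennreal (1 / (1 - x \<bullet> z) ^ Suc ?n))"
        using z le1[of z] \<gamma>[of "x \<bullet> z"] by (cases "z \<in> ?L") auto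
    qed
  qed
  also have "\<dots> = ennreal (fact ?n) * (\<integral>\<^sup>+z. indicator ?L z * ennreal (1 / (1 - x \<bullet> z) ^ Suc ?n) \<partial>lborel)"
    by (rule nn_integral_cmult) measurable
  finally show ?thesis by (simp add: ennreal_mult_cancel_left)
qed

section \<open>Tails of a linear functional on a symmetric convex body\<close>

definition slab_tail :: "'a::euclidean_space set \<Rightarrow> 'a \<Rightarrow> real \<Rightarrow> real" where
  "slab_tail L x r = measure lborel {y \<in> L. r \<le> \<bar>x \<bullet> y\<bar>}"

lemma compact_cap:
  fixes L :: "'a::euclidean_space set"
  assumes "compact L"
  shows "compact {y \<in> L. r \<le> x \<bullet> y}" "compact {y \<in> L. r \<le> \<bar>x \<bullet> y\<bar>}"
proof -
  have "closed {y. r \<le> x \<bullet> y}" "closed {y. r \<le> \<bar>x \<bullet> y\<bar>}"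
    by (auto intro!: closed_Collect_le continuous_intros)
  then show "compact {y \<in> L. r \<le> x \<bullet> y}" "compact {y \<in> L. r \<le> \<bar>x \<bullet> y\<bar>}"
    using assms by (auto simp: Collect_conj_eq compact_Int_closed)
qed

lemma slab_tail_nonneg: "0 \<le> slab_tail L x r"
  by (simp add: slab_tail_def)

lemma slab_tail_0: "slab_tail L x 0 = measure lborel L"
  by (simp add: slab_tail_def)

lemma slab_tail_antimono:
  fixes L :: "'a::euclidean_space set"
  assumes "compact L" "r \<le> s" shows "slab_tail L x s \<le> slab_tail L x r"
  unfolding slab_tail_def using assms
  by (intro measure_mono_fmeasurable)
    (auto intro!: compact_fmeasurable compact_cap borel_compact)

lemma emeasure_slab:
  fixes L :: "'a::euclidean_space set"
  assumes "compact L" shows "emeasure lborel {y \<in> L. r \<le> \<bar>x \<bullet> y\<bar>} = ennreal (slab_tail L x r)"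
  using compact_fmeasurable[OF compact_cap(2)[OF assms, of r x]]
  by (simp add: slab_tail_def emeasure_eq_measure2)

lemma slab_tail_measurable:
  assumes "compact L" shows "slab_tail L x \<in> borel_measurable borel"
proof -
  have "mono (\<lambda>r. - slab_tail L x r)" using slab_tail_antimono[OF assms] by (auto simp: mono_def)
  then have "(\<lambda>r. - slab_tail L x r) \<in> borel_measurable borel" by (rule borel_measurable_mono)
  then show ?thesis by simp
qed

text \<open>The two caps \<open>x \<bullet> y \<ge> r\<close> and \<open>x \<bullet> y \<le> - r\<close> are reflections of each other. For \<open>r \<le> 0\<close> they
  overlap, which leaves only an inequality.\<close>

lemma slab_tail_caps:
  fixes L :: "'a::euclidean_space set"
  assumes L: "compact L" and sym: "\<And>y. y \<in> L \<Longrightarrow> - y \<in> L"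
  shows "slab_tail L x r \<le> 2 * measure lborel {y \<in> L. r \<le> x \<bullet> y}"
    and "0 < r \<Longrightarrow> slab_tail L x r = 2 * measure lborel {y \<in> L. r \<le> x \<bullet> y}"
proof -
  let ?C = "{y \<in> L. r \<le> x \<bullet> y}" and ?C' = "{y \<in> L. x \<bullet> y \<le> - r}"
  have im: "?C' = (\<lambda>y. (- 1) *\<^sub>R y + 0) ` ?C"
  proof (intro equalityI subsetI)
    fix y assume "y \<in> ?C'"
    then have "- y \<in> ?C" using sym by auto
    then show "y \<in> (\<lambda>y. (- 1) *\<^sub>R y + 0) ` ?C" by (rule rev_image_eqI) simp
  qed (use sym in auto)
  have m: "measure lborel ?C' = measure lborel ?C"
    unfolding im using measure_lborel_scale[OF compact_cap(1)[OF L], of "-1" 0 r x] by simp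
  have cC: "compact ?C" by (intro compact_cap L)
  then have cC': "compact ?C'" unfolding im by (intro compact_continuous_image continuous_intros)
  have un: "slab_tail L x r \<le> measure lborel (?C \<union> ?C')"
    unfolding slab_tail_def using cC cC'
    by (intro measure_mono_fmeasurable) (auto intro!: compact_fmeasurable compact_Un borel_compact compact_cap L)
  also have "\<dots> \<le> measure lborel ?C + measure lborel ?C'"
    using cC cC' by (intro measure_Un_le) (auto intro!: borel_compact)
  finally show "slab_tail L x r \<le> 2 * measure lborel ?C" using m by simp
  assume r: "0 < r"
  have "{y \<in> L. r \<le> \<bar>x \<bullet> y\<bar>} = ?C \<union> ?C'" by auto
  then have "slab_tail L x r = measure lborel (?C \<union> ?C')" by (simp add: slab_tail_def)
  also have "\<dots> = measure lborel ?C + measure lborel ?C'"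
    using compact_fmeasurable[OF cC] compact_fmeasurable[OF cC'] r
    by (intro measure_Union) (auto simp: fmeasurable_def)
  finally show "slab_tail L x r = 2 * measure lborel ?C" using m by simp
qed

text \<open>A convex combination of the half \<open>x \<bullet> y \<ge> 0\<close> of \<open>L\<close> and the cap \<open>x \<bullet> y \<ge> r\<close> is contained in the cap
  \<open>x \<bullet> y \<ge> \<theta> * r\<close>, so this is the Brunn--Minkowski inequality for these two sets. The point \<open>p\<close> ensures that
  the cap at level \<open>r\<close> is not empty; it may well have volume 0.\<close>

theorem slab_tail_concave:
  fixes L :: "'a::euclidean_space set"
  assumes L: "compact L" "convex L" and sym: "\<And>y. y \<in> L \<Longrightarrow> - y \<in> L"
    and \<theta>: "0 \<le> \<theta>" "\<theta> \<le> 1" and r: "0 \<le> r" and p: "p \<in> L" "r \<le> \<bar>x \<bullet> p\<bar>"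
  shows "((1 - \<theta>) * root DIM('a) (measure lborel L) + \<theta> * root DIM('a) (slab_tail L x r)) ^ DIM('a)
    \<le> slab_tail L x (\<theta> * r)"
proof (cases "\<theta> = 0 \<or> r = 0")
  case True
  then show ?thesis by (auto simp: slab_tail_0 left_diff_distrib)
next
  case False
  with \<theta> r have pos: "0 < \<theta>" "0 < r" "0 < \<theta> * r" by auto
  let ?n = "DIM('a)" and ?cap = "\<lambda>r. {y \<in> L. r \<le> x \<bullet> y}" and ?m = "measure lborel :: 'a set \<Rightarrow> real"
  have cap: "compact (?cap s)" "convex (?cap s)" for s
  proof -
    have "?cap s = L \<inter> {y. x \<bullet> y \<ge> s}" by auto
    then show "convex (?cap s)" using L by (metis convex_Int convex_halfspace_ge)
  qed (intro compact_cap L)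
  obtain q where q: "q \<in> L" "r \<le> x \<bullet> q"
    using p sym[OF p(1)] by (cases "0 \<le> x \<bullet> p") auto
  have ne: "?cap r \<noteq> {}" "?cap 0 \<noteq> {}" using q pos by force+
  let ?A = "(\<lambda>y. (1 - \<theta>) *\<^sub>R y + 0) ` ?cap 0" and ?B = "(\<lambda>y. \<theta> *\<^sub>R y + 0) ` ?cap r"
  have "(root ?n (?m ?A) + root ?n (?m ?B)) ^ ?n \<le> ?m (?cap (\<theta> * r))"
  proof (rule brunn_minkowski_convex)
    show "compact ?A" "compact ?B" using cap by (auto intro!: compact_continuous_image continuous_intros)
    show "convex ?A" "convex ?B" using cap by (auto intro!: convex_scaling)
    show "?A + ?B \<subseteq> ?cap (\<theta> * r)"
    proof
      fix z assume "z \<in> ?A + ?B"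
      then obtain u v where uv: "u \<in> ?cap 0" "v \<in> ?cap r" "z = (1 - \<theta>) *\<^sub>R u + \<theta> *\<^sub>R v"
        by (auto simp: set_plus_def)
      then have "z \<in> L" using L(2) \<theta> by (auto intro!: convexD)
      moreover have "\<theta> * r \<le> (1 - \<theta>) * (x \<bullet> u) + \<theta> * (x \<bullet> v)"
        using uv(1,2) \<theta> by (intro add_increasing mult_nonneg_nonneg mult_left_mono) auto
      ultimately show "z \<in> ?cap (\<theta> * r)" using uv(3) by (simp add: inner_simps)
    qed
  qed (use ne cap in auto)
  moreover have "?m ?A = (1 - \<theta>) ^ ?n * ?m (?cap 0)" "?m ?B = \<theta> ^ ?n * ?m (?cap r)"
    using measure_lborel_scale[OF cap(1)[of 0], of "1 - \<theta>" 0] measure_lborel_scale[OF cap(1)[of r], of \<theta> 0] \<theta>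
    by simp_all
  ultimately have bm: "((1 - \<theta>) * root ?n (?m (?cap 0)) + \<theta> * root ?n (?m (?cap r))) ^ ?n \<le> ?m (?cap (\<theta> * r))"
    using \<theta> by (simp add: real_root_mult real_root_power_cancel)
  have "root ?n (?m L) \<le> root ?n (2 * ?m (?cap 0))"
    using slab_tail_caps(1)[OF L(1) sym, of x 0] by (simp add: slab_tail_0)
  then have "((1 - \<theta>) * root ?n (?m L) + \<theta> * root ?n (slab_tail L x r)) ^ ?n
      \<le> ((1 - \<theta>) * root ?n (2 * ?m (?cap 0)) + \<theta> * root ?n (2 * ?m (?cap r))) ^ ?n"
    using \<theta> slab_tail_caps(2)[OF L(1) sym pos(2)]
    by (intro power_mono add_mono add_nonneg_nonneg mult_left_mono mult_nonneg_nonneg) auto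
  also have "\<dots> = (root ?n 2 * ((1 - \<theta>) * root ?n (?m (?cap 0)) + \<theta> * root ?n (?m (?cap r)))) ^ ?n"
    by (simp add: real_root_mult algebra_simps)
  also have "\<dots> = 2 * ((1 - \<theta>) * root ?n (?m (?cap 0)) + \<theta> * root ?n (?m (?cap r))) ^ ?n"
    by (simp add: power_mult_distrib)
  also have "\<dots> \<le> 2 * ?m (?cap (\<theta> * r))" using bm by simp
  also have "\<dots> = slab_tail L x (\<theta> * r)" by (rule slab_tail_caps(2)[OF L(1) sym pos(3), symmetric])
  finally show ?thesis .
qed

text \<open>The layer cake formula, with \<open>F\<close> the primitive of \<open>\<phi>\<close> that vanishes at 0.\<close>

lemma nn_integral_slab_tail:
  fixes L :: "'a::euclidean_space set" and \<phi> F :: "real \<Rightarrow> real"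
  assumes L: "compact L" and [measurable]: "\<phi> \<in> borel_measurable borel"
    and F: "\<And>y. y \<in> L \<Longrightarrow> (\<integral>\<^sup>+r. ennreal (\<phi> r) * indicator {0..\<bar>x \<bullet> y\<bar>} r \<partial>lborel) = ennreal (F \<bar>x \<bullet> y\<bar>)"
  shows "(\<integral>\<^sup>+y. indicator L y * ennreal (F \<bar>x \<bullet> y\<bar>) \<partial>lborel)
    = (\<integral>\<^sup>+r. indicator {0..} r * ennreal (\<phi> r) * ennreal (slab_tail L x r) \<partial>lborel)"
proof -
  have [measurable]: "L \<in> sets borel" using L by (rule borel_compact)
  have "(\<integral>\<^sup>+y. indicator L y * ennreal (F \<bar>x \<bullet> y\<bar>) \<partial>lborel)
      = (\<integral>\<^sup>+y. (\<integral>\<^sup>+r. indicator L y * (ennreal (\<phi> r) * indicator {r. 0 \<le> r \<and> r \<le> \<bar>x \<bullet> y\<bar>} r) \<partial>lborel) \<partial>lborel)"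
  proof (rule nn_integral_cong)
    fix y :: 'a
    show "indicator L y * ennreal (F \<bar>x \<bullet> y\<bar>)
      = (\<integral>\<^sup>+r. indicator L y * (ennreal (\<phi> r) * indicator {r. 0 \<le> r \<and> r \<le> \<bar>x \<bullet> y\<bar>} r) \<partial>lborel)"
      using F[of y] by (cases "y \<in> L") (simp_all add: atLeastAtMost_def atLeast_def atMost_def Collect_conj_eq)
  qed
  also have "\<dots> = (\<integral>\<^sup>+r. (\<integral>\<^sup>+y. indicator L y * (ennreal (\<phi> r) * indicator {r. 0 \<le> r \<and> r \<le> \<bar>x \<bullet> y\<bar>} r) \<partial>lborel) \<partial>lborel)"
    by (rule lborel_pair.Fubini') measurable
  also have "\<dots> = (\<integral>\<^sup>+r. indicator {0..} r * ennreal (\<phi> r) * ennreal (slab_tail L x r) \<partial>lborel)"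
  proof (rule nn_integral_cong)
    fix r :: real
    have [measurable]: "{y \<in> L. r \<le> \<bar>x \<bullet> y\<bar>} \<in> sets borel" using compact_cap(2)[OF L] by (rule borel_compact)
    have "(\<integral>\<^sup>+y. indicator L y * (ennreal (\<phi> r) * indicator {r. 0 \<le> r \<and> r \<le> \<bar>x \<bullet> y\<bar>} r) \<partial>lborel)
        = (\<integral>\<^sup>+y. indicator {0..} r * ennreal (\<phi> r) * indicator {y \<in> L. r \<le> \<bar>x \<bullet> y\<bar>} y \<partial>lborel)"
      by (intro nn_integral_cong) (auto simp: indicator_def)
    also have "\<dots> = indicator {0..} r * ennreal (\<phi> r) * ennreal (slab_tail L x r)"
      by (subst nn_integral_cmult_indicator) (simp_all add: emeasure_slab[OF L])
    finally show "(\<integral>\<^sup>+y. indicator L y * (ennreal (\<phi> r) * indicator {r. 0 \<le> r \<and> r \<le> \<bar>x \<bullet> y\<bar>} r) \<partial>lborel)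
        = indicator {0..} r * ennreal (\<phi> r) * ennreal (slab_tail L x r)" .
  qed
  finally show ?thesis .
qed

text \<open>The tail \<open>(1 - r/\<rho>)\<^sup>n\<close> belongs to a double cone whose apexes have height \<open>\<rho>\<close>.\<close>

lemma nn_integral_cone_second_moment:
  fixes \<rho> :: real
  assumes \<rho>: "0 < \<rho>"
  shows "(\<integral>\<^sup>+r. ennreal (2 * r * (1 - r / \<rho>) ^ n) * indicator {0..\<rho>} r \<partial>lborel)
    = ennreal (2 * \<rho>\<^sup>2 / ((real n + 1) * (real n + 2)))"
proof -
  define N where "N = real n"
  have N: "0 < N + 1" "0 < N + 2" "real n = N" by (auto simp: N_def)
  define w where "w r = 1 - r / \<rho>" for r
  have w: "(w has_real_derivative - (1 / \<rho>)) (at r)" for r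
    unfolding w_def using \<rho> by (auto intro!: derivative_eq_intros)
  have dw: "((\<lambda>r. w r ^ Suc k) has_real_derivative (1 + real k) * ((- (1 / \<rho>)) * w r ^ k)) (at r)" for r k
    by (rule DERIV_power_Suc[OF w])
  define a b where "a = - 2 * \<rho> / (N + 1)" and "b = - 2 * \<rho>\<^sup>2 / ((N + 1) * (N + 2))"
  define F where "F r = a * (r * w r ^ Suc n) + b * w r ^ Suc (Suc n)" for r
  have "(\<integral>\<^sup>+r. ennreal (2 * r * w r ^ n) * indicator {0..\<rho>} r \<partial>lborel) = ennreal (F \<rho> - F 0)"
  proof (rule nn_integral_FTC_Icc)
    fix r assume "r \<in> {0..\<rho>}"
    then have r: "0 \<le> r" "r \<le> \<rho>" by simp_all
    define u where "u = w r ^ n"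
    have "(F has_real_derivative
        a * (1 * w r ^ Suc n + (1 + real n) * ((- (1 / \<rho>)) * w r ^ n) * r)
        + b * ((1 + real (Suc n)) * ((- (1 / \<rho>)) * w r ^ Suc n))) (at r)"
      unfolding F_def by (rule DERIV_add[OF DERIV_cmult[OF DERIV_mult[OF DERIV_ident dw]] DERIV_cmult[OF dw]])
    also have "a * (1 * w r ^ Suc n + (1 + real n) * ((- (1 / \<rho>)) * w r ^ n) * r)
        + b * ((1 + real (Suc n)) * ((- (1 / \<rho>)) * w r ^ Suc n))
        = a * (w r * u - (N + 1) / \<rho> * u * r) - b * ((N + 2) / \<rho> * (w r * u))"
      by (simp add: N_def u_def algebra_simps add_divide_distrib)
    also have "\<dots> = (- 2 * \<rho> / (N + 1) * (w r * u) + 2 * u * r) + 2 * \<rho> / (N + 1) * (w r * u)"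
    proof -
      have "a * ((N + 1) / \<rho> * u * r) = - 2 * u * r" "a * (w r * u) = - 2 * \<rho> / (N + 1) * (w r * u)"
        using N \<rho> by (simp_all add: a_def)
      moreover have "b * ((N + 2) / \<rho>) = - 2 * \<rho> / (N + 1)"
      proof -
        have "b * ((N + 2) / \<rho>) = - 2 * \<rho> * (\<rho> / \<rho>) * ((N + 2) / (N + 2)) / (N + 1)"
          by (simp add: b_def power2_eq_square)
        then show ?thesis using N \<rho> by simp
      qed
      then have "b * ((N + 2) / \<rho> * (w r * u)) = - 2 * \<rho> / (N + 1) * (w r * u)"
        by (simp only: mult.assoc[symmetric])
      ultimately show ?thesis by (simp add: right_diff_distrib)
    qed
    also have "\<dots> = 2 * r * u" by simp
    finally show "(F has_real_derivative 2 * r * w r ^ n) (at r)" by (simp add: u_def)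
    show "0 \<le> 2 * r * w r ^ n"
      using r \<rho> by (intro mult_nonneg_nonneg zero_le_power) (auto simp: w_def)
  qed (use \<rho> in \<open>auto simp: w_def\<close>)
  also have "F \<rho> - F 0 = 2 * \<rho>\<^sup>2 / ((real n + 1) * (real n + 2))"
    using \<rho> by (simp add: F_def w_def b_def N_def)
  finally show ?thesis by (simp add: w_def)
qed

text \<open>Among bodies of given width the double cone has the smallest second moment: concavity of the tail
  between the levels \<open>0\<close> and \<open>M = \<bar>x \<bullet> p\<bar>\<close> bounds it from below by the tail of the double cone of
  height \<open>M\<close>.\<close>

lemma second_moment_ge_width:
  fixes L :: "'a::euclidean_space set"
  assumes L: "compact L" "convex L" and sym: "\<And>y. y \<in> L \<Longrightarrow> - y \<in> L"
    and a: "(\<integral>\<^sup>+y. indicator L y * ennreal ((x \<bullet> y)\<^sup>2) \<partial>lborel) = ennreal (a * measure lborel L)"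
    and m: "0 < measure lborel L" and a0: "0 \<le> a" and p: "p \<in> L"
  shows "(x \<bullet> p)\<^sup>2 \<le> (real DIM('a) + 1) * (real DIM('a) + 2) / 2 * a"
proof (cases "x \<bullet> p = 0")
  case True
  then show ?thesis using a0 by simp
next
  case False
  let ?n = "DIM('a)"
  define M where "M = \<bar>x \<bullet> p\<bar>"
  have M: "0 < M" using False by (simp add: M_def)
  define m where "m = measure lborel L"
  have m0: "0 < m" using assms by (simp add: m_def)
  have tail: "m * (1 - r / M) ^ ?n \<le> slab_tail L x r" if r: "0 \<le> r" "r \<le> M" for r
  proof -
    have "((1 - r / M) * root ?n m + r / M * root ?n (slab_tail L x M)) ^ ?n \<le> slab_tail L x (r / M * M)"
      unfolding m_def by (rule slab_tail_concave[OF L sym _ _ _ p]) (use r M in \<open>auto simp: M_def\<close>)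
    moreover have "((1 - r / M) * root ?n m) ^ ?n \<le> ((1 - r / M) * root ?n m + r / M * root ?n (slab_tail L x M)) ^ ?n"
      using r M m0 by (intro power_mono) (auto simp: slab_tail_nonneg)
    ultimately show ?thesis using M m0 by (simp add: power_mult_distrib mult.commute)
  qed
  have "ennreal (m * (2 * M\<^sup>2 / ((real ?n + 1) * (real ?n + 2))))
      = ennreal m * (\<integral>\<^sup>+r. ennreal (2 * r * (1 - r / M) ^ ?n) * indicator {0..M} r \<partial>lborel)"
    using m0 by (subst nn_integral_cone_second_moment[OF M], subst ennreal_mult[symmetric]) auto
  also have "\<dots> = (\<integral>\<^sup>+r. ennreal m * (ennreal (2 * r * (1 - r / M) ^ ?n) * indicator {0..M} r) \<partial>lborel)"
    by (rule nn_integral_cmult[symmetric]) measurable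
  also have "\<dots> \<le> (\<integral>\<^sup>+r. indicator {0..} r * ennreal (2 * r) * ennreal (slab_tail L x r) \<partial>lborel)"
  proof (rule nn_integral_mono)
    fix r :: real
    show "ennreal m * (ennreal (2 * r * (1 - r / M) ^ ?n) * indicator {0..M} r)
      \<le> indicator {0..} r * ennreal (2 * r) * ennreal (slab_tail L x r)"
    proof (cases "0 \<le> r \<and> r \<le> M")
      case True
      then have "2 * r * (m * (1 - r / M) ^ ?n) \<le> 2 * r * slab_tail L x r"
        by (intro mult_left_mono tail) auto
      then have "ennreal (m * (2 * r * (1 - r / M) ^ ?n)) \<le> ennreal (2 * r * slab_tail L x r)"
        by (intro ennreal_leI) (simp add: mult_ac)
      then show ?thesis using True m0 M by (simp add: ennreal_mult slab_tail_nonneg)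
    qed (auto simp: indicator_def)
  qed
  also have "\<dots> = (\<integral>\<^sup>+y. indicator L y * ennreal (\<bar>x \<bullet> y\<bar>\<^sup>2) \<partial>lborel)"
  proof (rule nn_integral_slab_tail[symmetric, OF L(1)])
    fix y
    have "(\<integral>\<^sup>+r. ennreal (2 * r) * indicator {0..\<bar>x \<bullet> y\<bar>} r \<partial>lborel) = ennreal (\<bar>x \<bullet> y\<bar>\<^sup>2 - 0\<^sup>2)"
      by (rule nn_integral_FTC_Icc) (auto intro!: derivative_eq_intros)
    then show "(\<integral>\<^sup>+r. ennreal (2 * r) * indicator {0..\<bar>x \<bullet> y\<bar>} r \<partial>lborel) = ennreal (\<bar>x \<bullet> y\<bar>\<^sup>2)" by simp
  qed simp
  also have "\<dots> = ennreal (a * m)" using a by (simp add: m_def)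
  finally have "m * (2 * M\<^sup>2 / ((real ?n + 1) * (real ?n + 2))) \<le> a * m"
    using m0 a0 by (subst (asm) ennreal_le_iff) auto
  then have "2 * M\<^sup>2 / ((real ?n + 1) * (real ?n + 2)) \<le> a" using m0 by (metis mult.commute mult_le_cancel_left_pos)
  then have "2 * M\<^sup>2 \<le> a * ((real ?n + 1) * (real ?n + 2))"
    by (subst (asm) pos_divide_le_eq) (auto intro: mult_pos_pos)
  then show ?thesis by (simp add: M_def algebra_simps)
qed

text \<open>The hypothesis \<open>conc\<close> says that the \<open>n\<close>-th root of \<open>T\<close> lies above its chords from \<open>(0, 1)\<close>, whereas for the
  cone \<open>C r = (1 - r/\<rho>)\<^sup>n\<close> this root is linear. So \<open>T \<ge> C\<close> holds on an initial interval with end point \<open>r0\<close> and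
  \<open>T \<le> C\<close> holds beyond. Since \<open>\<phi> r / r\<close> is increasing, \<open>\<phi> r - B * (2 * r)\<close> with \<open>B = \<phi> r0 / (2 * r0)\<close> changes
  sign at \<open>r0\<close> as well, in the opposite direction, and \<open>\<integral> (\<phi> r - B * (2 * r)) (T r - C r) dr \<le> 0\<close>. The terms
  with \<open>B\<close> cancel because the second moments agree.\<close>

lemma nn_integral_single_crossing:
  fixes T \<phi> :: "real \<Rightarrow> real"
  assumes n: "0 < n" and \<rho>: "0 < \<rho>"
    and [measurable]: "T \<in> borel_measurable borel" "\<phi> \<in> borel_measurable borel"
    and T0: "T 0 = 1" and Tn: "\<And>r. 0 \<le> T r"
    and conc: "\<And>\<theta> r. 0 \<le> \<theta> \<Longrightarrow> \<theta> \<le> 1 \<Longrightarrow> 0 \<le> r \<Longrightarrow> 0 < T r \<Longrightarrow>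
        (1 - \<theta> + \<theta> * root n (T r)) ^ n \<le> T (\<theta> * r)"
    and \<phi>0: "\<And>r. 0 \<le> r \<Longrightarrow> r \<le> \<rho> \<Longrightarrow> 0 \<le> \<phi> r" "\<phi> 0 = 0"
    and star: "\<And>r s. 0 \<le> r \<Longrightarrow> r \<le> s \<Longrightarrow> s \<le> \<rho> \<Longrightarrow> \<phi> r * s \<le> \<phi> s * r"
    and mom: "(\<integral>\<^sup>+r. ennreal (2 * r * T r) * indicator {0..\<rho>} r \<partial>lborel)
      = (\<integral>\<^sup>+r. ennreal (2 * r * (1 - r / \<rho>) ^ n) * indicator {0..\<rho>} r \<partial>lborel)"
  shows "(\<integral>\<^sup>+r. ennreal (\<phi> r * T r) * indicator {0..\<rho>} r \<partial>lborel)
    \<le> (\<integral>\<^sup>+r. ennreal (\<phi> r * (1 - r / \<rho>) ^ n) * indicator {0..\<rho>} r \<partial>lborel)"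
proof -
  define C where "C r = (1 - r / \<rho>) ^ n" for r
  have [measurable]: "C \<in> borel_measurable borel" unfolding C_def by measurable
  have C_nonneg: "0 \<le> C r" if "0 \<le> r" "r \<le> \<rho>" for r using that \<rho> by (simp add: C_def)
  define P where "P = {r. 0 \<le> r \<and> r < \<rho> \<and> C r \<le> T r}"
  have P0: "0 \<in> P" using \<rho> T0 by (auto simp: P_def C_def)
  have P_down: "s \<in> P" if "r \<in> P" "0 \<le> s" "s \<le> r" for r s
  proof (cases "r = 0")
    case True
    then show ?thesis using that P0 by auto
  next
    case False
    with that have r: "0 < r" "r < \<rho>" "C r \<le> T r" by (auto simp: P_def)
    have Cr: "0 < C r" using r by (simp add: C_def)
    have rt: "1 - r / \<rho> \<le> root n (T r)"
      using real_root_le_mono[OF n r(3)] n r by (simp add: C_def real_root_power_cancel)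
    have "1 - s / \<rho> = 1 - s / r + s / r * (1 - r / \<rho>)" using r by (simp add: field_simps)
    also have "\<dots> \<le> 1 - s / r + s / r * root n (T r)"
      using rt that r by (intro add_left_mono mult_left_mono) auto
    finally have "C s \<le> (1 - s / r + s / r * root n (T r)) ^ n"
      unfolding C_def using that r by (intro power_mono) auto
    also have "\<dots> \<le> T (s / r * r)" using that r Cr by (intro conc) auto
    finally show ?thesis using r that by (simp add: P_def)
  qed
  define r0 where "r0 = Sup P"
  have bdd: "bdd_above P" by (rule bdd_aboveI[of _ \<rho>]) (auto simp: P_def)
  have r0: "0 \<le> r0" "r0 \<le> \<rho>"
    using cSup_upper[OF P0 bdd] cSup_least[of P \<rho>] P0 by (auto simp: r0_def P_def)
  have below: "C r \<le> T r" if r: "0 \<le> r" "r < r0" for r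
  proof -
    have "P \<noteq> {}" using P0 by blast
    then obtain s where "s \<in> P" "r < s" using less_cSupD[of P r] r(2) unfolding r0_def by blast
    then show ?thesis using P_down[of s r] r by (auto simp: P_def)
  qed
  have above: "T r \<le> C r" if "r0 < r" "r < \<rho>" for r
  proof -
    have "r \<notin> P" using cSup_upper[OF _ bdd, of r] that(1) by (auto simp: r0_def)
    then show ?thesis using that r0 by (auto simp: P_def)
  qed
  \<comment> \<open>If \<open>r0 = 0\<close> then \<open>T \<le> C\<close> on all of \<open>[0, \<rho>)\<close>, and already the case \<open>B = 0\<close> gives the right sign.\<close>
  define B where "B = (if r0 = 0 then 0 else \<phi> r0 / (2 * r0))"
  have B0: "0 \<le> B" using r0 \<phi>0 by (simp add: B_def)
  have sign: "(\<phi> r - B * (2 * r)) * (T r - C r) \<le> 0" if r: "0 \<le> r" "r < \<rho>" for r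
  proof (cases "r0 = 0")
    case True
    show ?thesis
    proof (cases "r = 0")
      case False
      then have "T r \<le> C r" using above[of r] r True by auto
      then show ?thesis using True r \<phi>0(1)[of r] by (simp add: B_def mult_nonneg_nonpos)
    qed (simp add: \<phi>0)
  next
    case False
    then have p: "0 < r0" using r0 by simp
    then have B: "B * (2 * r) = \<phi> r0 * r / r0" by (simp add: B_def)
    consider "r < r0" | "r = r0" | "r0 < r" by linarith
    then show ?thesis
    proof cases
      case 1
      then have "\<phi> r \<le> B * (2 * r)" using star[of r r0] r r0 p unfolding B by (simp add: field_simps)
      moreover have "C r \<le> T r" using below r 1 by simp
      ultimately show ?thesis by (simp add: mult_nonpos_nonneg)
    next
      case 2
      then have "\<phi> r - B * (2 * r) = 0" using p unfolding B by simp
      then show ?thesis by simp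
    next
      case 3
      then have "B * (2 * r) \<le> \<phi> r" using star[of r0 r] r r0 p unfolding B by (simp add: field_simps)
      moreover have "T r \<le> C r" using above r 3 by simp
      ultimately show ?thesis by (simp add: mult_nonneg_nonpos)
    qed
  qed
  let ?I = "\<lambda>f. \<integral>\<^sup>+r. ennreal (f r) * indicator {0..\<rho>} r \<partial>lborel"
  have add: "?I (\<lambda>r. f r + B * g r) = ?I f + ennreal B * ?I g"
    if [measurable]: "f \<in> borel_measurable borel" "g \<in> borel_measurable borel"
      and "\<And>r. 0 \<le> r \<Longrightarrow> r \<le> \<rho> \<Longrightarrow> 0 \<le> f r" "\<And>r. 0 \<le> r \<Longrightarrow> r \<le> \<rho> \<Longrightarrow> 0 \<le> g r" for f g :: "real \<Rightarrow> real"
  proof -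
    have "?I (\<lambda>r. f r + B * g r) = (\<integral>\<^sup>+r. ennreal (f r) * indicator {0..\<rho>} r + ennreal B * (ennreal (g r) * indicator {0..\<rho>} r) \<partial>lborel)"
      using that(3,4) B0 by (intro nn_integral_cong) (auto simp: indicator_def ennreal_mult)
    then show ?thesis by (simp add: nn_integral_add nn_integral_cmult)
  qed
  \<comment> \<open>The inequality is rearranged into sums of nonnegative terms, so that it can be integrated without
    integrability conditions. The point \<open>r = \<rho>\<close> is excluded because \<open>T \<rho>\<close> may exceed \<open>C \<rho> = 0\<close>.\<close>
  have "?I (\<lambda>r. \<phi> r * T r) + ennreal B * ?I (\<lambda>r. 2 * r * C r) = ?I (\<lambda>r. \<phi> r * T r + B * (2 * r * C r))"
    by (rule add[symmetric]) (auto intro!: mult_nonneg_nonneg \<phi>0 Tn C_nonneg)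
  also have "\<dots> \<le> ?I (\<lambda>r. \<phi> r * C r + B * (2 * r * T r))"
  proof (rule nn_integral_mono_AE)
    show "AE r in lborel. ennreal (\<phi> r * T r + B * (2 * r * C r)) * indicator {0..\<rho>} r
        \<le> ennreal (\<phi> r * C r + B * (2 * r * T r)) * indicator {0..\<rho>} r"
      using AE_lborel_singleton[of \<rho>]
    proof eventually_elim
      fix r assume "r \<noteq> \<rho>"
      then show "ennreal (\<phi> r * T r + B * (2 * r * C r)) * indicator {0..\<rho>} r
        \<le> ennreal (\<phi> r * C r + B * (2 * r * T r)) * indicator {0..\<rho>} r"
        using sign[of r] by (auto simp: indicator_def algebra_simps intro!: ennreal_leI)
    qed
  qed
  also have "\<dots> = ?I (\<lambda>r. \<phi> r * C r) + ennreal B * ?I (\<lambda>r. 2 * r * T r)"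
    by (rule add) (auto intro!: mult_nonneg_nonneg \<phi>0 Tn C_nonneg)
  also have "?I (\<lambda>r. 2 * r * T r) = ?I (\<lambda>r. 2 * r * C r)" using mom by (simp add: C_def)
  finally have le: "ennreal B * ?I (\<lambda>r. 2 * r * C r) + ?I (\<lambda>r. \<phi> r * T r)
      \<le> ennreal B * ?I (\<lambda>r. 2 * r * C r) + ?I (\<lambda>r. \<phi> r * C r)"
    by (simp add: add.commute)
  have "ennreal B * ?I (\<lambda>r. 2 * r * C r) \<noteq> top"
    unfolding C_def nn_integral_cone_second_moment[OF \<rho>] by (simp add: ennreal_mult_eq_top_iff)
  then have "?I (\<lambda>r. \<phi> r * T r) \<le> ?I (\<lambda>r. \<phi> r * C r)"
    using le by (simp add: ennreal_add_left_cancel_le)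
  then show ?thesis by (simp add: C_def)
qed

section \<open>Inverse powers, symmetrised\<close>

text \<open>These are the even and the odd part of \<open>(1 - s)\<^bsup>-k\<^esup>\<close>.\<close>

definition sym_inverse_power :: "nat \<Rightarrow> real \<Rightarrow> real" where
  "sym_inverse_power k s = (1 / (1 - s) ^ k + 1 / (1 + s) ^ k) / 2"

definition antisym_inverse_power :: "nat \<Rightarrow> real \<Rightarrow> real" where
  "antisym_inverse_power k s = (1 / (1 - s) ^ k - 1 / (1 + s) ^ k) / 2"

lemma inverse_power_measurable [measurable]:
  "sym_inverse_power k \<in> borel_measurable borel" "antisym_inverse_power k \<in> borel_measurable borel"
  unfolding sym_inverse_power_def[abs_def] antisym_inverse_power_def[abs_def] by measurable

lemma sym_inverse_power_abs: "sym_inverse_power k \<bar>s\<bar> = sym_inverse_power k s"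
  by (simp add: sym_inverse_power_def abs_if add.commute)

lemma antisym_inverse_power_0: "antisym_inverse_power k 0 = 0"
  by (simp add: antisym_inverse_power_def)

lemma antisym_inverse_power_nonneg:
  assumes "0 \<le> s" "s < 1" shows "0 \<le> antisym_inverse_power k s"
proof -
  have "(1 - s) ^ k \<le> (1 + s) ^ k" using assms by (intro power_mono) auto
  then show ?thesis using assms by (simp add: antisym_inverse_power_def divide_simps)
qed

lemma DERIV_inverse_powers:
  assumes "\<bar>s\<bar> < 1"
  shows "((\<lambda>s. 1 / (1 - s) ^ Suc k) has_real_derivative real (Suc k) / (1 - s) ^ (k + 2)) (at s)"
    and "((\<lambda>s. 1 / (1 + s) ^ Suc k) has_real_derivative - real (Suc k) / (1 + s) ^ (k + 2)) (at s)"
proof -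
  have p: "1 - s \<noteq> 0" "1 + s \<noteq> 0" using assms by auto
  have "((\<lambda>s. inverse ((1 - s) ^ Suc k)) has_real_derivative
      - (inverse ((1 - s) ^ Suc k) * ((1 + real k) * ((- 1) * (1 - s) ^ k)) * inverse ((1 - s) ^ Suc k))) (at s)"
    by (rule DERIV_inverse'[OF DERIV_power_Suc]) (use p in \<open>auto intro!: derivative_eq_intros\<close>)
  also have "- (inverse ((1 - s) ^ Suc k) * ((1 + real k) * ((- 1) * (1 - s) ^ k)) * inverse ((1 - s) ^ Suc k))
      = real (Suc k) / (1 - s) ^ (k + 2)"
    using p by (simp add: divide_simps)
  finally show "((\<lambda>s. 1 / (1 - s) ^ Suc k) has_real_derivative real (Suc k) / (1 - s) ^ (k + 2)) (at s)"
    by (simp only: inverse_eq_divide)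
  have "((\<lambda>s. inverse ((1 + s) ^ Suc k)) has_real_derivative
      - (inverse ((1 + s) ^ Suc k) * ((1 + real k) * (1 * (1 + s) ^ k)) * inverse ((1 + s) ^ Suc k))) (at s)"
    by (rule DERIV_inverse'[OF DERIV_power_Suc]) (use p in \<open>auto intro!: derivative_eq_intros\<close>)
  also have "- (inverse ((1 + s) ^ Suc k) * ((1 + real k) * (1 * (1 + s) ^ k)) * inverse ((1 + s) ^ Suc k))
      = - real (Suc k) / (1 + s) ^ (k + 2)"
    using p by (simp add: divide_simps)
  finally show "((\<lambda>s. 1 / (1 + s) ^ Suc k) has_real_derivative - real (Suc k) / (1 + s) ^ (k + 2)) (at s)"
    by (simp only: inverse_eq_divide)
qed

lemma DERIV_sym_inverse_power:
  assumes "\<bar>s\<bar> < 1"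
  shows "(sym_inverse_power (Suc k) has_real_derivative real (Suc k) * antisym_inverse_power (k + 2) s) (at s)"
    and "(antisym_inverse_power (Suc k) has_real_derivative real (Suc k) * sym_inverse_power (k + 2) s) (at s)"
proof -
  note D = DERIV_inverse_powers[OF assms, of k]
  have alg: "(c / X + - c / Y) / 2 = c * ((1 / X - 1 / Y) / 2)" "(c / X - - c / Y) / 2 = c * ((1 / X + 1 / Y) / 2)"
    for c X Y :: real
    by (simp_all add: right_diff_distrib distrib_left)
  show "(sym_inverse_power (Suc k) has_real_derivative real (Suc k) * antisym_inverse_power (k + 2) s) (at s)"
    unfolding sym_inverse_power_def[abs_def]
    by (rule DERIV_cong[OF DERIV_cdivide[OF DERIV_add[OF D]]]) (simp only: antisym_inverse_power_def alg)
  show "(antisym_inverse_power (Suc k) has_real_derivative real (Suc k) * sym_inverse_power (k + 2) s) (at s)"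
    unfolding antisym_inverse_power_def[abs_def]
    by (rule DERIV_cong[OF DERIV_cdivide[OF DERIV_diff[OF D]]]) (simp only: sym_inverse_power_def alg)
qed

text \<open>The odd part is convex on \<open>[0, 1)\<close> and vanishes at 0, so its quotient by \<open>s\<close> is increasing.\<close>

lemma antisym_inverse_power_star:
  assumes rs: "0 \<le> r" "r \<le> s" "s < 1"
  shows "antisym_inverse_power (Suc k) r * s \<le> antisym_inverse_power (Suc k) s * r"
proof (cases "s = 0")
  case False
  with rs have s: "0 < s" by simp
  have "convex_on {0..<1} (antisym_inverse_power (Suc k))"
  proof (rule f''_ge0_imp_convex)
    fix x :: real assume x: "x \<in> {0..<1}"
    then have x1: "\<bar>x\<bar> < 1" by simp
    show "(antisym_inverse_power (Suc k) has_real_derivative real (Suc k) * sym_inverse_power (Suc (Suc k)) x) (at x)"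
      using DERIV_sym_inverse_power(2)[OF x1, of k] by simp
    show "((\<lambda>x. real (Suc k) * sym_inverse_power (Suc (Suc k)) x) has_real_derivative
        real (Suc k) * (real (Suc (Suc k)) * antisym_inverse_power (Suc k + 2) x)) (at x)"
      by (intro DERIV_cmult DERIV_sym_inverse_power x1)
    show "0 \<le> real (Suc k) * (real (Suc (Suc k)) * antisym_inverse_power (Suc k + 2) x)"
      using x by (intro mult_nonneg_nonneg antisym_inverse_power_nonneg) auto
  qed (rule convex_real_interval)
  then have "antisym_inverse_power (Suc k) ((1 - r / s) *\<^sub>R 0 + (r / s) *\<^sub>R s)
      \<le> (1 - r / s) * antisym_inverse_power (Suc k) 0 + r / s * antisym_inverse_power (Suc k) s"
    using rs s by (intro convex_onD) auto
  then have "antisym_inverse_power (Suc k) r \<le> r / s * antisym_inverse_power (Suc k) s"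
    using s by (simp add: antisym_inverse_power_0)
  then have "antisym_inverse_power (Suc k) r * s \<le> r / s * antisym_inverse_power (Suc k) s * s"
    using s by (intro mult_right_mono) auto
  then show ?thesis using s by (simp add: mult_ac)
qed (use rs in simp)

text \<open>The value for the double cone of height \<open>\<rho>\<close>, which is the extremal case of the bound below.\<close>

lemma nn_integral_cone_inverse_power:
  fixes \<rho> :: real
  assumes \<rho>: "0 < \<rho>" "\<rho> < 1"
  shows "(\<integral>\<^sup>+r. ennreal (real (Suc n) * antisym_inverse_power (n + 2) r * (1 - r / \<rho>) ^ n) * indicator {0..\<rho>} r \<partial>lborel)
    = ennreal (\<rho>\<^sup>2 / (1 - \<rho>\<^sup>2))"
proof -
  \<comment> \<open>Up to constants, \<open>((\<rho> - r) / (1 - r))\<^bsup>n+1\<^esup>\<close> and \<open>((\<rho> - r) / (1 + r))\<^bsup>n+1\<^esup>\<close> are primitives of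
    \<open>(\<rho> - r)\<^sup>n / (1 - r)\<^bsup>n+2\<^esup>\<close> and \<open>(\<rho> - r)\<^sup>n / (1 + r)\<^bsup>n+2\<^esup>\<close>.\<close>
  define F where "F r = (((\<rho> - r) / (1 - r)) ^ Suc n / ((\<rho> - 1) * \<rho> ^ n)
      - ((\<rho> - r) / (1 + r)) ^ Suc n / ((\<rho> + 1) * \<rho> ^ n) * (- 1)) / 2" for r
  have "(\<integral>\<^sup>+r. ennreal (real (Suc n) * antisym_inverse_power (n + 2) r * (1 - r / \<rho>) ^ n) * indicator {0..\<rho>} r \<partial>lborel)
      = ennreal (F \<rho> - F 0)"
  proof (rule nn_integral_FTC_Icc)
    fix r assume "r \<in> {0..\<rho>}"
    then have r: "0 \<le> r" "r \<le> \<rho>" "1 - r \<noteq> 0" "1 + r \<noteq> 0" using \<rho> by auto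
    have d1: "((\<lambda>r. (\<rho> - r) / (1 - r)) has_real_derivative (\<rho> - 1) / (1 - r)\<^sup>2) (at r)"
      using r by (auto intro!: derivative_eq_intros simp: power2_eq_square algebra_simps)
    have d2: "((\<lambda>r. (\<rho> - r) / (1 + r)) has_real_derivative - (\<rho> + 1) / (1 + r)\<^sup>2) (at r)"
      using r by (auto intro!: derivative_eq_intros simp: power2_eq_square algebra_simps)
    have "(F has_real_derivative
        ((1 + real n) * ((\<rho> - 1) / (1 - r)\<^sup>2 * ((\<rho> - r) / (1 - r)) ^ n) / ((\<rho> - 1) * \<rho> ^ n)
        - (1 + real n) * (- (\<rho> + 1) / (1 + r)\<^sup>2 * ((\<rho> - r) / (1 + r)) ^ n) / ((\<rho> + 1) * \<rho> ^ n) * (- 1)) / 2) (at r)"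
      unfolding F_def
      by (intro DERIV_cdivide DERIV_diff DERIV_cmult_right DERIV_power_Suc d1 d2)
    also have "((1 + real n) * ((\<rho> - 1) / (1 - r)\<^sup>2 * ((\<rho> - r) / (1 - r)) ^ n) / ((\<rho> - 1) * \<rho> ^ n)
        - (1 + real n) * (- (\<rho> + 1) / (1 + r)\<^sup>2 * ((\<rho> - r) / (1 + r)) ^ n) / ((\<rho> + 1) * \<rho> ^ n) * (- 1)) / 2
        = real (Suc n) * antisym_inverse_power (n + 2) r * (1 - r / \<rho>) ^ n"
    proof -
      have "(1 - r / \<rho>) ^ n = (\<rho> - r) ^ n / \<rho> ^ n" using \<rho> by (simp add: diff_divide_distrib flip: power_divide)
      moreover have "(\<rho> - 1) / (1 - r)\<^sup>2 * ((\<rho> - r) / (1 - r)) ^ n / ((\<rho> - 1) * \<rho> ^ n)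
          = (\<rho> - r) ^ n / \<rho> ^ n / (1 - r) ^ (n + 2)"
        using \<rho> r by (simp add: power_divide power_add power2_eq_square)
      moreover have "- (\<rho> + 1) / (1 + r)\<^sup>2 * ((\<rho> - r) / (1 + r)) ^ n / ((\<rho> + 1) * \<rho> ^ n)
          = - ((\<rho> - r) ^ n / \<rho> ^ n / (1 + r) ^ (n + 2))"
      proof -
        have "- c / q * X / (c * Y) = - (X / Y / q)" if "c \<noteq> 0" for c q X Y :: real
          using that by simp
        then have "- (\<rho> + 1) / (1 + r)\<^sup>2 * ((\<rho> - r) / (1 + r)) ^ n / ((\<rho> + 1) * \<rho> ^ n)
            = - (((\<rho> - r) / (1 + r)) ^ n / \<rho> ^ n / (1 + r)\<^sup>2)"
          using \<rho> by (metis add_pos_pos less_irrefl zero_less_one)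
        also have "\<dots> = - ((\<rho> - r) ^ n / \<rho> ^ n / (1 + r) ^ (n + 2))"
          by (simp add: power_divide power_add power2_eq_square mult_ac)
        finally show ?thesis .
      qed
      ultimately show ?thesis
        by (simp only: times_divide_eq_right[symmetric] mult.assoc) (simp add: antisym_inverse_power_def algebra_simps)
    qed
    finally show "(F has_real_derivative real (Suc n) * antisym_inverse_power (n + 2) r * (1 - r / \<rho>) ^ n) (at r)" .
    show "0 \<le> real (Suc n) * antisym_inverse_power (n + 2) r * (1 - r / \<rho>) ^ n"
      using r \<rho> by (intro mult_nonneg_nonneg antisym_inverse_power_nonneg zero_le_power) auto
  qed (use \<rho> in auto)
  also have "F \<rho> - F 0 = \<rho>\<^sup>2 / (1 - \<rho>\<^sup>2)"
  proof -
    have "F 0 = (\<rho> / (\<rho> - 1) + \<rho> / (\<rho> + 1)) / 2" using \<rho> by (simp add: F_def)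
    also have "\<dots> = - (\<rho>\<^sup>2 / (1 - \<rho>\<^sup>2))"
    proof -
      have "\<rho> - 1 \<noteq> 0" "\<rho> + 1 \<noteq> 0" "1 - \<rho>\<^sup>2 \<noteq> 0"
        using \<rho> by (auto simp: power2_eq_1_iff)
      moreover have "1 - \<rho>\<^sup>2 = - ((\<rho> - 1) * (\<rho> + 1))" by (simp add: power2_eq_square algebra_simps)
      ultimately show ?thesis by (simp add: divide_simps) (simp add: power2_eq_square algebra_simps)
    qed
    finally have "F 0 = - (\<rho>\<^sup>2 / (1 - \<rho>\<^sup>2))" .
    moreover have "F \<rho> = 0" by (simp add: F_def)
    ultimately show ?thesis by simp
  qed
  finally show ?thesis .
qed

text \<open>The second moment and the integral in question are both integrals of the tail, against \<open>2 r\<close> and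
  against the derivative of the even part of \<open>(1 - s)\<^bsup>-(n+1)\<^esup>\<close>. Comparison with the double cone of the same
  second moment, which has height \<open>\<rho>\<close>, gives the bound. Its height is also a bound for \<open>\<bar>x \<bullet> y\<bar>\<close> on \<open>L\<close>, so
  the singularity at 1 is not met.\<close>

theorem nn_integral_inverse_power_le:
  fixes L :: "'a::euclidean_space set"
  assumes L: "compact L" "convex L" and sym: "\<And>y. y \<in> L \<Longrightarrow> - y \<in> L"
    and a: "(\<integral>\<^sup>+y. indicator L y * ennreal ((x \<bullet> y)\<^sup>2) \<partial>lborel) = ennreal (a * measure lborel L)"
    and m: "0 < measure lborel L" and a0: "0 \<le> a"
    and small: "(real DIM('a) + 1) * (real DIM('a) + 2) / 2 * a < 1"
  shows "(\<integral>\<^sup>+y. indicator L y * ennreal (sym_inverse_power (Suc DIM('a)) (x \<bullet> y)) \<partial>lborel)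
    \<le> ennreal (measure lborel L / (1 - (real DIM('a) + 1) * (real DIM('a) + 2) / 2 * a))"
proof -
  let ?n = "DIM('a)" and ?m = "measure lborel L"
  define \<rho> where "\<rho> = sqrt ((real ?n + 1) * (real ?n + 2) / 2 * a)"
  have \<rho>2: "\<rho>\<^sup>2 = (real ?n + 1) * (real ?n + 2) / 2 * a" using a0 by (simp add: \<rho>_def)
  have \<rho>: "0 \<le> \<rho>" "\<rho> < 1" using a0 small by (auto simp: \<rho>_def)
  have width: "\<bar>x \<bullet> y\<bar> \<le> \<rho>" if "y \<in> L" for y
    using second_moment_ge_width[OF L sym a m a0 that] \<rho>(1) unfolding \<rho>2[symmetric]
    by (metis abs_le_square_iff abs_of_nonneg)
  have [measurable]: "L \<in> sets borel" using L(1) by (rule borel_compact)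
  have fL: "emeasure lborel L = ennreal ?m"
    using compact_fmeasurable[OF L(1)] by (simp add: emeasure_eq_measure2)
  define \<phi> where "\<phi> r = real (Suc ?n) * antisym_inverse_power (?n + 2) r" for r
  have [measurable]: "\<phi> \<in> borel_measurable borel" unfolding \<phi>_def by measurable
  define T where "T r = slab_tail L x r / ?m" for r
  have [measurable]: "slab_tail L x \<in> borel_measurable borel" by (rule slab_tail_measurable[OF L(1)])
  have [measurable]: "T \<in> borel_measurable borel" unfolding T_def by measurable
  have tailT: "slab_tail L x r = ?m * T r" for r using m by (simp add: T_def)
  have T_nonneg: "0 \<le> T r" for r using m by (simp add: T_def slab_tail_nonneg)
  have T_zero: "T r = 0" if "\<rho> < r" for r
  proof -
    have "{y \<in> L. r \<le> \<bar>x \<bullet> y\<bar>} = {}" using width that by force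
    then show ?thesis unfolding T_def slab_tail_def by (simp only: measure_empty)
  qed
  have \<phi>_nonneg: "0 \<le> \<phi> r" if "0 \<le> r" "r \<le> \<rho>" for r
    using that \<rho> unfolding \<phi>_def by (intro mult_nonneg_nonneg antisym_inverse_power_nonneg) auto
  have cake: "(\<integral>\<^sup>+y. indicator L y * ennreal (F \<bar>x \<bullet> y\<bar>) \<partial>lborel)
      = ennreal ?m * (\<integral>\<^sup>+r. ennreal (\<psi> r * T r) * indicator {0..\<rho>} r \<partial>lborel)"
    if [measurable]: "\<psi> \<in> borel_measurable borel" and \<psi>: "\<And>r. 0 \<le> r \<Longrightarrow> r \<le> \<rho> \<Longrightarrow> 0 \<le> \<psi> r"
      "F 0 = 0" "\<And>r. 0 \<le> r \<Longrightarrow> r \<le> \<rho> \<Longrightarrow> (F has_real_derivative \<psi> r) (at r)" for \<psi> F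
  proof -
    have "(\<integral>\<^sup>+y. indicator L y * ennreal (F \<bar>x \<bullet> y\<bar>) \<partial>lborel)
        = (\<integral>\<^sup>+r. indicator {0..} r * ennreal (\<psi> r) * ennreal (slab_tail L x r) \<partial>lborel)"
    proof (rule nn_integral_slab_tail[OF L(1)])
      fix y assume "y \<in> L"
      then have "(\<integral>\<^sup>+r. ennreal (\<psi> r) * indicator {0..\<bar>x \<bullet> y\<bar>} r \<partial>lborel) = ennreal (F \<bar>x \<bullet> y\<bar> - F 0)"
        using width[of y] by (intro nn_integral_FTC_Icc \<psi>) auto
      then show "(\<integral>\<^sup>+r. ennreal (\<psi> r) * indicator {0..\<bar>x \<bullet> y\<bar>} r \<partial>lborel) = ennreal (F \<bar>x \<bullet> y\<bar>)"
        by (simp add: \<psi>)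
    qed simp
    also have "\<dots> = (\<integral>\<^sup>+r. ennreal ?m * (ennreal (\<psi> r * T r) * indicator {0..\<rho>} r) \<partial>lborel)"
    proof (rule nn_integral_cong)
      fix r :: real
      show "indicator {0..} r * ennreal (\<psi> r) * ennreal (slab_tail L x r)
        = ennreal ?m * (ennreal (\<psi> r * T r) * indicator {0..\<rho>} r)"
        using \<psi>(1)[of r] T_nonneg[of r] T_zero[of r] m
        by (cases "0 \<le> r"; cases "r \<le> \<rho>") (auto simp: tailT ennreal_mult mult_ac)
    qed
    also have "\<dots> = ennreal ?m * (\<integral>\<^sup>+r. ennreal (\<psi> r * T r) * indicator {0..\<rho>} r \<partial>lborel)"
      by (rule nn_integral_cmult) measurable
    finally show ?thesis .
  qed
  define G where "G s = sym_inverse_power (Suc ?n) s - 1" for s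
  have G0: "G 0 = 0" by (simp add: G_def sym_inverse_power_def)
  have dG: "(G has_real_derivative \<phi> r) (at r)" if "0 \<le> r" "r \<le> \<rho>" for r
  proof -
    have "\<bar>r\<bar> < 1" using that \<rho> by simp
    from DERIV_diff[OF DERIV_sym_inverse_power(1)[OF this, of ?n] DERIV_const[of 1]]
    show ?thesis unfolding G_def[abs_def] \<phi>_def by simp
  qed
  have G_nonneg: "0 \<le> G s" if "0 \<le> s" "s \<le> \<rho>" for s
    using DERIV_nonneg_imp_nondecreasing[of 0 s G] that dG \<phi>_nonneg G0 by (metis order_trans)
  have bound: "(\<integral>\<^sup>+r. ennreal (\<phi> r * T r) * indicator {0..\<rho>} r \<partial>lborel) \<le> ennreal (\<rho>\<^sup>2 / (1 - \<rho>\<^sup>2))"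
  proof (cases "\<rho> = 0")
    case True
    then have "(\<integral>\<^sup>+r. ennreal (\<phi> r * T r) * indicator {0..\<rho>} r \<partial>lborel) = (\<integral>\<^sup>+r. 0 \<partial>(lborel :: real measure))"
      by (intro nn_integral_cong) (auto simp: indicator_def \<phi>_def antisym_inverse_power_0)
    then show ?thesis by simp
  next
    case False
    then have pos: "0 < \<rho>" using \<rho> by simp
    have "(\<integral>\<^sup>+r. ennreal (\<phi> r * T r) * indicator {0..\<rho>} r \<partial>lborel)
      \<le> (\<integral>\<^sup>+r. ennreal (\<phi> r * (1 - r / \<rho>) ^ ?n) * indicator {0..\<rho>} r \<partial>lborel)"
    proof (rule nn_integral_single_crossing[OF _ pos])
      show "T 0 = 1" using m by (simp add: T_def slab_tail_0)
      show "\<phi> 0 = 0" by (simp add: \<phi>_def antisym_inverse_power_0)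
      fix r s assume "0 \<le> r" "r \<le> s" "s \<le> \<rho>"
      then show "\<phi> r * s \<le> \<phi> s * r"
        using antisym_inverse_power_star[of r s "Suc ?n"] \<rho> by (simp add: \<phi>_def mult.assoc mult_left_mono)
    next
      fix \<theta> r :: real assume \<theta>: "0 \<le> \<theta>" "\<theta> \<le> 1" and r: "0 \<le> r" "0 < T r"
      have "{y \<in> L. r \<le> \<bar>x \<bullet> y\<bar>} \<noteq> {}"
        using r(2) unfolding T_def slab_tail_def by (metis divide_eq_0_iff less_irrefl measure_empty)
      then obtain p where p: "p \<in> L" "r \<le> \<bar>x \<bullet> p\<bar>" by blast
      have "?m * (1 - \<theta> + \<theta> * root ?n (T r)) ^ ?n = (root ?n ?m * (1 - \<theta> + \<theta> * root ?n (T r))) ^ ?n"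
        using m by (simp add: power_mult_distrib)
      also have "root ?n ?m * (1 - \<theta> + \<theta> * root ?n (T r)) = (1 - \<theta>) * root ?n ?m + \<theta> * root ?n (slab_tail L x r)"
        by (simp add: tailT real_root_mult algebra_simps)
      also have "\<dots> ^ ?n \<le> ?m * T (\<theta> * r)"
        unfolding tailT[symmetric] by (rule slab_tail_concave[OF L sym \<theta> r(1) p])
      finally show "(1 - \<theta> + \<theta> * root ?n (T r)) ^ ?n \<le> T (\<theta> * r)" using m by simp
    next
      have "ennreal ?m * (\<integral>\<^sup>+r. ennreal (2 * r * T r) * indicator {0..\<rho>} r \<partial>lborel)
          = (\<integral>\<^sup>+y. indicator L y * ennreal (\<bar>x \<bullet> y\<bar>\<^sup>2) \<partial>lborel)"
        by (rule cake[symmetric]) (auto intro!: derivative_eq_intros)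
      also have "\<dots> = ennreal ?m * ennreal a" using a a0 m by (simp add: ennreal_mult mult.commute)
      finally have "(\<integral>\<^sup>+r. ennreal (2 * r * T r) * indicator {0..\<rho>} r \<partial>lborel) = ennreal a"
        using m by (simp add: ennreal_mult_cancel_left)
      also have "a = 2 * \<rho>\<^sup>2 / ((real ?n + 1) * (real ?n + 2))"
      proof -
        have "(real ?n + 1) * (real ?n + 2) \<noteq> 0" by (simp add: add_eq_0_iff)
        then show ?thesis unfolding \<rho>2 by simp
      qed
      also have "ennreal \<dots> = (\<integral>\<^sup>+r. ennreal (2 * r * (1 - r / \<rho>) ^ ?n) * indicator {0..\<rho>} r \<partial>lborel)"
        by (rule nn_integral_cone_second_moment[OF pos, symmetric])
      finally show "(\<integral>\<^sup>+r. ennreal (2 * r * T r) * indicator {0..\<rho>} r \<partial>lborel)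
        = (\<integral>\<^sup>+r. ennreal (2 * r * (1 - r / \<rho>) ^ ?n) * indicator {0..\<rho>} r \<partial>lborel)" .
    qed (use T_nonneg \<phi>_nonneg in simp_all)
    also have "\<dots> = ennreal (\<rho>\<^sup>2 / (1 - \<rho>\<^sup>2))"
      unfolding \<phi>_def by (rule nn_integral_cone_inverse_power[OF pos \<rho>(2)])
    finally show ?thesis .
  qed
  have "(\<integral>\<^sup>+y. indicator L y * ennreal (sym_inverse_power (Suc ?n) (x \<bullet> y)) \<partial>lborel)
      = (\<integral>\<^sup>+y. indicator L y + indicator L y * ennreal (G \<bar>x \<bullet> y\<bar>) \<partial>lborel)"
  proof (rule nn_integral_cong)
    fix y
    show "indicator L y * ennreal (sym_inverse_power (Suc ?n) (x \<bullet> y)) = indicator L y + indicator L y * ennreal (G \<bar>x \<bullet> y\<bar>)"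
    proof (cases "y \<in> L")
      case True
      have "ennreal (sym_inverse_power (Suc ?n) (x \<bullet> y)) = ennreal (1 + G \<bar>x \<bullet> y\<bar>)"
        by (simp add: G_def sym_inverse_power_abs)
      also have "\<dots> = 1 + ennreal (G \<bar>x \<bullet> y\<bar>)"
        using G_nonneg[of "\<bar>x \<bullet> y\<bar>"] width[OF True] by (subst ennreal_plus) auto
      finally show ?thesis using True by simp
    qed simp
  qed
  also have "\<dots> = emeasure lborel L + (\<integral>\<^sup>+y. indicator L y * ennreal (G \<bar>x \<bullet> y\<bar>) \<partial>lborel)"
    unfolding G_def by (subst nn_integral_add) auto
  also have "(\<integral>\<^sup>+y. indicator L y * ennreal (G \<bar>x \<bullet> y\<bar>) \<partial>lborel)
      = ennreal ?m * (\<integral>\<^sup>+r. ennreal (\<phi> r * T r) * indicator {0..\<rho>} r \<partial>lborel)"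
    by (rule cake) (use \<phi>_nonneg G0 dG in auto)
  also have "emeasure lborel L + ennreal ?m * (\<integral>\<^sup>+r. ennreal (\<phi> r * T r) * indicator {0..\<rho>} r \<partial>lborel)
      \<le> ennreal ?m + ennreal ?m * ennreal (\<rho>\<^sup>2 / (1 - \<rho>\<^sup>2))"
    unfolding fL by (intro add_mono mult_left_mono bound) auto
  also have "\<dots> = ennreal (?m / (1 - \<rho>\<^sup>2))"
  proof -
    have "0 < 1 - \<rho>\<^sup>2" using small \<rho>2 by simp
    then have "?m / (1 - \<rho>\<^sup>2) = ?m + ?m * (\<rho>\<^sup>2 / (1 - \<rho>\<^sup>2))" by (simp add: field_simps)
    moreover have "0 \<le> ?m * (\<rho>\<^sup>2 / (1 - \<rho>\<^sup>2))" using \<open>0 < 1 - \<rho>\<^sup>2\<close> by simp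
    moreover have "ennreal ?m * ennreal (\<rho>\<^sup>2 / (1 - \<rho>\<^sup>2)) = ennreal (?m * (\<rho>\<^sup>2 / (1 - \<rho>\<^sup>2)))"
      using \<open>0 < 1 - \<rho>\<^sup>2\<close> by (intro ennreal_mult[symmetric]) auto
    ultimately show ?thesis by (simp only: ennreal_plus measure_nonneg)
  qed
  finally show ?thesis unfolding \<rho>2 .
qed

section \<open>Lower bounds for symmetrised inverse powers\<close>

text \<open>From \<open>(1 - s)\<^bsup>-(k+1)\<^esup> = (1 + s) (1 - s)\<^bsup>-k\<^esup> / (1 - s\<^sup>2)\<close> one gets a recursion that couples the even and
  the odd part, so the two bounds are proved together; the factor \<open>1 / (1 - s\<^sup>2)\<close> is at least \<open>1 + s\<^sup>2\<close>.\<close>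

lemma inverse_power_quadratic:
  assumes s: "\<bar>s\<bar> < 1"
  shows "1 + real k * (real k + 1) / 2 * s\<^sup>2 \<le> sym_inverse_power k s"
    and "real k * s\<^sup>2 \<le> s * antisym_inverse_power k s"
proof (induction k)
  case 0
  show "1 + real 0 * (real 0 + 1) / 2 * s\<^sup>2 \<le> sym_inverse_power 0 s" "real 0 * s\<^sup>2 \<le> s * antisym_inverse_power 0 s"
    by (simp_all add: sym_inverse_power_def antisym_inverse_power_def)
next
  case (Suc k)
  have p: "1 - s \<noteq> 0" "1 + s \<noteq> 0" and s2: "s\<^sup>2 < 1" using s by (auto simp: abs_square_less_1)
  have rec: "1 / (1 - s) ^ Suc k = (1 + s) / (1 - s\<^sup>2) * (1 / (1 - s) ^ k)"
      "1 / (1 + s) ^ Suc k = (1 - s) / (1 - s\<^sup>2) * (1 / (1 + s) ^ k)"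
  proof -
    have "1 - s\<^sup>2 = (1 - s) * (1 + s)" by (simp add: power2_eq_square algebra_simps)
    then show "1 / (1 - s) ^ Suc k = (1 + s) / (1 - s\<^sup>2) * (1 / (1 - s) ^ k)"
      "1 / (1 + s) ^ Suc k = (1 - s) / (1 - s\<^sup>2) * (1 / (1 + s) ^ k)"
      using p by simp_all
  qed
  have alg: "((1 + s) / D * P + (1 - s) / D * Q) / 2 = ((P + Q) / 2 + s * ((P - Q) / 2)) / D"
      "s * (((1 + s) / D * P - (1 - s) / D * Q) / 2) = (s * ((P - Q) / 2) + s\<^sup>2 * ((P + Q) / 2)) / D"
    for D P Q :: real
    by (cases "D = 0"; simp add: field_simps power2_eq_square)+
  let ?S = "sym_inverse_power k s" and ?A = "antisym_inverse_power k s"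
  have S: "sym_inverse_power (Suc k) s = (?S + s * ?A) / (1 - s\<^sup>2)"
    unfolding sym_inverse_power_def antisym_inverse_power_def rec by (rule alg(1))
  have A: "s * antisym_inverse_power (Suc k) s = (s * ?A + s\<^sup>2 * ?S) / (1 - s\<^sup>2)"
    unfolding sym_inverse_power_def antisym_inverse_power_def rec by (rule alg(2))
  have ge: "x * (1 + s\<^sup>2) \<le> x / (1 - s\<^sup>2)" if "0 \<le> x" for x
  proof -
    have "x * (1 + s\<^sup>2) * (1 - s\<^sup>2) = x * (1 - s\<^sup>2 * s\<^sup>2)" by (simp add: algebra_simps)
    also have "\<dots> \<le> x" using that by (simp add: mult_left_le)
    finally show ?thesis using s2 by (simp add: pos_le_divide_eq)
  qed
  define y where "y = s\<^sup>2"
  have y: "0 \<le> y" by (simp add: y_def)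
  have IH: "1 + real k * (real k + 1) / 2 * y \<le> ?S" "real k * y \<le> s * ?A" using Suc by (simp_all add: y_def)
  define X where "X = 1 + real k * (real k + 1) / 2 * y + real k * y"
  have X0: "0 \<le> X" using y by (simp add: X_def)
  have "1 + real (Suc k) * (real (Suc k) + 1) / 2 * y \<le> X * (1 + y)"
  proof -
    have "X * (1 + y) = 1 + real (Suc k) * (real (Suc k) + 1) / 2 * y + y * (X - 1)"
      by (simp add: X_def field_simps)
    moreover have "0 \<le> y * (X - 1)" using y by (simp add: X_def)
    ultimately show ?thesis by simp
  qed
  also have "\<dots> \<le> X / (1 - s\<^sup>2)" using ge[OF X0] by (simp add: y_def)
  also have "\<dots> \<le> sym_inverse_power (Suc k) s"
    unfolding S using IH s2 by (intro divide_right_mono) (auto simp: X_def)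
  finally show "1 + real (Suc k) * (real (Suc k) + 1) / 2 * s\<^sup>2 \<le> sym_inverse_power (Suc k) s" by (simp add: y_def)
  have S1: "1 \<le> ?S" using IH(1) y by (smt (verit) mult_nonneg_nonneg of_nat_0_le_iff divide_nonneg_nonneg)
  have "real (Suc k) * y \<le> s * ?A + s\<^sup>2 * ?S"
    using IH(2) mult_left_mono[OF S1 y] by (simp add: y_def algebra_simps)
  also have "\<dots> \<le> (s * ?A + s\<^sup>2 * ?S) * (1 + s\<^sup>2)"
  proof -
    have "0 \<le> s * ?A + s\<^sup>2 * ?S" using IH(2) y S1 by (smt (verit) mult_nonneg_nonneg of_nat_0_le_iff y_def)
    then show ?thesis by (simp add: distrib_left)
  qed
  also have "\<dots> \<le> s * antisym_inverse_power (Suc k) s"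
    unfolding A using IH(2) y S1 by (intro ge) (smt (verit) mult_nonneg_nonneg of_nat_0_le_iff y_def)
  finally show "real (Suc k) * s\<^sup>2 \<le> s * antisym_inverse_power (Suc k) s" by (simp add: y_def)
qed

text \<open>The mean of \<open>(1 - s)\<^bsup>-k\<^esup>\<close> and \<open>(1 + s)\<^bsup>-k\<^esup>\<close> is at least their geometric mean \<open>(1 - s\<^sup>2)\<^bsup>-k/2\<^esup>\<close>, and
  \<open>1 - s\<^sup>2 \<le> (1 - s\<^sup>2/2)\<^sup>2\<close>.\<close>

lemma sym_inverse_power_ge_inverse_power:
  assumes s: "\<bar>s\<bar> < 1"
  shows "1 / (1 - s\<^sup>2 / 2) ^ k \<le> sym_inverse_power k s"
proof (rule power2_le_imp_le)
  have s2: "s\<^sup>2 < 1" using s by (simp add: abs_square_less_1)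
  have p: "0 < 1 - s" "0 < 1 + s" using s by auto
  define P Q where "P = 1 / (1 - s) ^ k" and "Q = 1 / (1 + s) ^ k"
  have "(1 - s\<^sup>2) ^ k \<le> ((1 - s\<^sup>2 / 2)\<^sup>2) ^ k"
  proof (rule power_mono)
    have "(1 - y / 2)\<^sup>2 = 1 - y + (y / 2)\<^sup>2" for y :: real by (simp add: power2_eq_square algebra_simps)
    then show "1 - s\<^sup>2 \<le> (1 - s\<^sup>2 / 2)\<^sup>2" by simp
  qed (use s2 in simp)
  then have "1 / ((1 - s\<^sup>2 / 2)\<^sup>2) ^ k \<le> 1 / (1 - s\<^sup>2) ^ k"
    using s2 by (intro divide_left_mono) auto
  also have "\<dots> = P * Q"
  proof -
    have "1 - s\<^sup>2 = (1 - s) * (1 + s)" by (simp add: power2_eq_square algebra_simps)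
    then show ?thesis by (simp add: P_def Q_def power_mult_distrib)
  qed
  also have "\<dots> \<le> ((P + Q) / 2)\<^sup>2"
  proof -
    have "((P + Q) / 2)\<^sup>2 - P * Q = ((P - Q) / 2)\<^sup>2" by (simp add: power2_eq_square field_simps)
    then show ?thesis using zero_le_power2[of "(P - Q) / 2"] by linarith
  qed
  also have "(P + Q) / 2 = sym_inverse_power k s" by (simp add: P_def Q_def sym_inverse_power_def)
  also have "1 / ((1 - s\<^sup>2 / 2)\<^sup>2) ^ k = (1 / (1 - s\<^sup>2 / 2) ^ k)\<^sup>2"
    by (simp add: power_divide power_commutes flip: power_mult) (simp add: mult.commute)
  finally show "(1 / (1 - s\<^sup>2 / 2) ^ k)\<^sup>2 \<le> (sym_inverse_power k s)\<^sup>2" .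
  show "0 \<le> sym_inverse_power k s" using p by (simp add: sym_inverse_power_def)
qed

text \<open>The left-hand side is the tangent at \<open>b\<close> of the convex function \<open>w\<^bsup>-k\<^esup>\<close>. The inequality follows from
  Bernoulli's inequality for \<open>(b/w)\<^sup>k\<close> and \<open>b/w + w/b \<ge> 2\<close>.\<close>

lemma inverse_power_tangent:
  fixes b w :: real
  assumes "0 < b" "0 < w"
  shows "1 / b ^ k * (1 + real k * (1 - w / b)) \<le> 1 / w ^ k"
proof -
  have "1 - w / b \<le> b / w - 1"
  proof -
    have "b / w - 1 - (1 - w / b) = (b - w)\<^sup>2 / (b * w)"
      using assms by (simp add: field_simps power2_eq_square)
    moreover have "0 \<le> (b - w)\<^sup>2 / (b * w)" using assms by simp
    ultimately show ?thesis by linarith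
  qed
  then have "1 + real k * (1 - w / b) \<le> 1 + real k * (b / w - 1)" by (simp add: mult_left_mono)
  also have "\<dots> \<le> (1 + (b / w - 1)) ^ k"
    using assms by (intro Bernoulli_inequality) simp
  also have "\<dots> = b ^ k / w ^ k" by (simp add: power_divide)
  finally have "1 / b ^ k * (1 + real k * (1 - w / b)) \<le> 1 / b ^ k * (b ^ k / w ^ k)"
    using assms by (intro mult_left_mono) auto
  then show ?thesis using assms by simp
qed

section \<open>Symmetric convex bodies and their polars\<close>

locale symmetric_body =
  fixes K :: "'a::euclidean_space set"
  assumes body: "convex_body K" and symmetric: "K = uminus ` K"
begin

abbreviation L :: "'a set" where "L \<equiv> polar_body K 0"
abbreviation m :: real where "m \<equiv> measure lborel L"

lemma compact_K: "compact K" and convex_K: "convex K"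
  using body by (auto simp: convex_body_def)

lemma zero_interior: "0 \<in> interior K"
proof -
  obtain c where c: "c \<in> interior K" using body by (auto simp: convex_body_def)
  have "- c \<in> uminus ` interior K" using c by blast
  then have "- c \<in> interior K" using interior_negations[of K] symmetric by simp
  moreover have "convex (interior K)" using convex_K by (rule convex_interior)
  ultimately have "(1 / 2) *\<^sub>R c + (1 / 2) *\<^sub>R (- c) \<in> interior K" using c by (intro convexD) auto
  then show ?thesis by simp
qed

lemma zero_in_K: "0 \<in> K"
  using zero_interior interior_subset by blast

lemma mem_L: "y \<in> L \<longleftrightarrow> (\<forall>z\<in>K. y \<bullet> z \<le> 1)"
  by (simp add: polar_body_def)

lemma uminus_L: "y \<in> L \<Longrightarrow> - y \<in> L"
  using symmetric unfolding mem_L by (metis imageE inner_minus_left inner_minus_right minus_minus)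

lemma convex_L: "convex L"
  unfolding convex_def
  by (auto simp: mem_L inner_add_left intro!: convex_bound_le)

lemma compact_L: "compact L"
proof -
  obtain e where e: "0 < e" "cball 0 e \<subseteq> K"
    using zero_interior by (auto simp: mem_interior_cball)
  have "norm y \<le> 1 / e" if "y \<in> L" for y
  proof (cases "y = 0")
    case False
    have "(e / norm y) *\<^sub>R y \<in> K" using e False by (intro subsetD[OF e(2)]) (simp add: dist_norm)
    then have "y \<bullet> ((e / norm y) *\<^sub>R y) \<le> 1" using that unfolding mem_L by blast
    moreover have "y \<bullet> ((e / norm y) *\<^sub>R y) = e * norm y"
      using False by (simp add: dot_square_norm power2_eq_square)
    ultimately have "e * norm y \<le> 1" by simp
    then show ?thesis using e by (simp add: field_simps)
  qed (use e in simp)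
  then have "bounded L" by (auto simp: bounded_iff)
  then show ?thesis by (simp add: compact_eq_bounded_closed closed_polar_body)
qed

lemma cball_subset_L: "\<exists>d>0. cball 0 d \<subseteq> L"
proof -
  obtain R where R: "\<And>z. z \<in> K \<Longrightarrow> norm z \<le> R"
    using compact_imp_bounded[OF compact_K] by (auto simp: bounded_iff)
  have "cball 0 (1 / (\<bar>R\<bar> + 1)) \<subseteq> L"
  proof
    fix y :: 'a assume "y \<in> cball 0 (1 / (\<bar>R\<bar> + 1))"
    then have y: "norm y \<le> 1 / (\<bar>R\<bar> + 1)" by (simp add: dist_norm)
    have "y \<bullet> z \<le> 1" if "z \<in> K" for z
    proof -
      have "y \<bullet> z \<le> norm y * norm z" by (rule norm_cauchy_schwarz)
      also have "\<dots> \<le> 1 / (\<bar>R\<bar> + 1) * (\<bar>R\<bar> + 1)"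
        using y R[OF that] by (intro mult_mono) auto
      also have "\<dots> = 1"
      proof -
        have "\<bar>R\<bar> + 1 \<noteq> 0" by arith
        then show ?thesis by simp
      qed
      finally show ?thesis .
    qed
    then show "y \<in> L" by (simp add: mem_L)
  qed
  then show ?thesis by (intro exI[of _ "1 / (\<bar>R\<bar> + 1)"]) auto
qed

lemma m_pos: "0 < m"
proof -
  obtain d where d: "0 < d" "cball 0 d \<subseteq> L" using cball_subset_L by blast
  have "0 < measure lborel (cball (0::'a) d)" using content_cball_pos[OF d(1)] .
  also have "\<dots> \<le> m" using d compact_L by (intro measure_mono_fmeasurable) (auto intro: compact_fmeasurable)
  finally show ?thesis .
qed

lemma volume_K_pos: "0 < measure lborel K"
proof -
  have "0 < measure lborel (interior K)"
    using zero_interior compact_imp_bounded[OF compact_K]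
    by (intro measure_lborel_open_pos open_bounded_fmeasurable) (auto intro: bounded_interior)
  then show ?thesis using measure_interior_convex[OF compact_K convex_K] by simp
qed

lemma bipolar:
  assumes "\<And>y. y \<in> L \<Longrightarrow> x \<bullet> y \<le> 1" shows "x \<in> K"
proof (rule ccontr)
  assume "x \<notin> K"
  then obtain a b where ab: "a \<bullet> x < b" "\<And>z. z \<in> K \<Longrightarrow> b < a \<bullet> z"
    using separating_hyperplane_closed_point[OF convex_K compact_imp_closed[OF compact_K]] by blast
  have b: "b < 0" using ab(2)[OF zero_in_K] by simp
  have "(1 / b) *\<^sub>R a \<in> L" using ab(2) b by (auto simp: mem_L divide_le_eq_1 intro: less_imp_le)
  from assms[OF this] show False using ab(1) b by (simp add: inner_commute divide_le_eq_1)
qed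

lemma abs_inner_le:
  assumes "x \<in> K" "y \<in> L" shows "\<bar>x \<bullet> y\<bar> \<le> 1"
  using assms(1) assms(2)[unfolded mem_L] uminus_L[OF assms(2), unfolded mem_L]
  by (auto simp: abs_le_iff inner_commute)

lemma emeasure_polar_symmetrised:
  assumes x: "x \<in> K"
  shows "emeasure lborel (polar_body K x)
    = (\<integral>\<^sup>+y. indicator L y * ennreal (sym_inverse_power (Suc DIM('a)) (x \<bullet> y)) \<partial>lborel)"
proof -
  let ?k = "Suc DIM('a)"
  have [measurable]: "L \<in> sets borel" by (simp add: closed_polar_body)
  let ?I = "\<lambda>f. \<integral>\<^sup>+y. indicator L y * ennreal (f (x \<bullet> y)) \<partial>lborel"
  have E: "emeasure lborel (polar_body K x) = ?I (\<lambda>s. 1 / (1 - s) ^ ?k)"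
    by (rule emeasure_polar_body[OF compact_K zero_in_K x])
  have "?I (\<lambda>s. 1 / (1 - s) ^ ?k) = (\<integral>\<^sup>+y. indicator L (- y) * ennreal (1 / (1 - x \<bullet> (- y)) ^ ?k) \<partial>lborel)"
    by (rule nn_integral_uminus[symmetric]) measurable
  also have "\<dots> = ?I (\<lambda>s. 1 / (1 + s) ^ ?k)"
  proof -
    have "indicator L (- y) = (indicator L y :: ennreal)" for y
      using uminus_L[of y] uminus_L[of "- y"] by (auto simp: indicator_def)
    then show ?thesis by simp
  qed
  finally have "2 * emeasure lborel (polar_body K x) = ?I (\<lambda>s. 1 / (1 - s) ^ ?k) + ?I (\<lambda>s. 1 / (1 + s) ^ ?k)"
    using E by (simp add: mult_2)
  also have "\<dots> = (\<integral>\<^sup>+y. indicator L y * ennreal (1 / (1 - x \<bullet> y) ^ ?k) + indicator L y * ennreal (1 / (1 + x \<bullet> y) ^ ?k) \<partial>lborel)"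
    by (rule nn_integral_add[symmetric]) measurable
  also have "\<dots> = (\<integral>\<^sup>+y. 2 * (indicator L y * ennreal (sym_inverse_power ?k (x \<bullet> y))) \<partial>lborel)"
  proof (rule nn_integral_cong)
    fix y
    show "indicator L y * ennreal (1 / (1 - x \<bullet> y) ^ ?k) + indicator L y * ennreal (1 / (1 + x \<bullet> y) ^ ?k)
      = 2 * (indicator L y * ennreal (sym_inverse_power ?k (x \<bullet> y)))"
    proof (cases "y \<in> L")
      case True
      then have s: "0 \<le> 1 - x \<bullet> y" "0 \<le> 1 + x \<bullet> y" using abs_inner_le[OF x, of y] by auto
      have "ennreal (1 / (1 - x \<bullet> y) ^ ?k) + ennreal (1 / (1 + x \<bullet> y) ^ ?k) = ennreal (2 * sym_inverse_power ?k (x \<bullet> y))"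
      proof -
        have "1 / (1 - x \<bullet> y) ^ ?k + 1 / (1 + x \<bullet> y) ^ ?k = 2 * sym_inverse_power ?k (x \<bullet> y)"
          unfolding sym_inverse_power_def by simp
        then show ?thesis
          using ennreal_plus[of "1 / (1 - x \<bullet> y) ^ ?k" "1 / (1 + x \<bullet> y) ^ ?k"] s by simp
      qed
      also have "\<dots> = 2 * ennreal (sym_inverse_power ?k (x \<bullet> y))" by (simp add: ennreal_mult')
      finally show ?thesis using True by simp
    qed simp
  qed
  also have "\<dots> = 2 * ?I (sym_inverse_power ?k)" by (rule nn_integral_cmult) measurable
  finally show ?thesis by (simp add: ennreal_mult_cancel_left)
qed

lemma integrable_inner_square: "integrable lborel (\<lambda>y. indicat_real L y * (x \<bullet> y)\<^sup>2)"
  using borel_integrable_compact[OF compact_L, of "\<lambda>y. (x \<bullet> y)\<^sup>2"] by (simp add: continuous_intros)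

lemma binet_norm_nonneg: "0 \<le> binet_norm L x"
  unfolding binet_norm_def set_lebesgue_integral_def
  by (intro real_sqrt_ge_zero mult_nonneg_nonneg integral_nonneg_AE) auto

lemma integral_inner_square:
  "(\<integral>y. indicat_real L y * (x \<bullet> y)\<^sup>2 \<partial>lborel) = (binet_norm L x)\<^sup>2 * m"
proof -
  have [measurable]: "L \<in> sets borel" by (simp add: closed_polar_body)
  define I where "I = (\<integral>y. indicat_real L y * (x \<bullet> y)\<^sup>2 \<partial>lborel)"
  have I0: "0 \<le> I" unfolding I_def by (intro integral_nonneg_AE) auto
  have "(\<lambda>y. indicat_real L y * (x \<bullet> y)\<^sup>2) \<in> borel_measurable lborel" by measurable
  from integral_completion[OF this] have "set_lebesgue_integral lebesgue L (\<lambda>y. (y \<bullet> x)\<^sup>2) = I"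
    by (simp add: set_lebesgue_integral_def I_def inner_commute)
  moreover have "measure lebesgue L = m" by simp
  ultimately have "binet_norm L x = sqrt (1 / m * I)" by (simp add: binet_norm_def)
  then show ?thesis using I0 m_pos by (simp add: I_def[symmetric])
qed

lemma nn_integral_inner_square:
  "(\<integral>\<^sup>+y. indicator L y * ennreal ((x \<bullet> y)\<^sup>2) \<partial>lborel) = ennreal ((binet_norm L x)\<^sup>2 * m)"
proof -
  have "(\<integral>\<^sup>+y. indicator L y * ennreal ((x \<bullet> y)\<^sup>2) \<partial>lborel) = (\<integral>\<^sup>+y. ennreal (indicat_real L y * (x \<bullet> y)\<^sup>2) \<partial>lborel)"
    by (intro nn_integral_cong) (auto simp: indicator_def)
  also have "\<dots> = ennreal ((binet_norm L x)\<^sup>2 * m)"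
    by (subst nn_integral_eq_integral[OF integrable_inner_square]) (auto simp: integral_inner_square)
  finally show ?thesis .
qed

lemma binet_norm_scale: "binet_norm L (c *\<^sub>R x) = \<bar>c\<bar> * binet_norm L x"
proof (rule power2_eq_imp_eq)
  have "(\<integral>y. indicat_real L y * (c *\<^sub>R x \<bullet> y)\<^sup>2 \<partial>lborel) = (\<integral>y. c\<^sup>2 * (indicat_real L y * (x \<bullet> y)\<^sup>2) \<partial>lborel)"
    by (intro Bochner_Integration.integral_cong) (auto simp: power_mult_distrib)
  then have "(binet_norm L (c *\<^sub>R x))\<^sup>2 * m = c\<^sup>2 * ((binet_norm L x)\<^sup>2 * m)"
    unfolding integral_inner_square Bochner_Integration.integral_mult_right_zero .
  then have "(binet_norm L (c *\<^sub>R x))\<^sup>2 * m = (\<bar>c\<bar> * binet_norm L x)\<^sup>2 * m"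
    by (simp only: power_mult_distrib power2_abs mult.assoc)
  then show "(binet_norm L (c *\<^sub>R x))\<^sup>2 = (\<bar>c\<bar> * binet_norm L x)\<^sup>2"
    using m_pos by (metis less_irrefl mult_right_cancel)
qed (auto simp: binet_norm_nonneg)

text \<open>Here \<open>L\<close> plays the role of the body in lemma \<open>second_moment_ge_width\<close>: the Binet norm controls the gauge of \<open>K\<close>.\<close>

lemma inner_square_le_binet:
  assumes "p \<in> L"
  shows "(x \<bullet> p)\<^sup>2 \<le> (real DIM('a) + 1) * (real DIM('a) + 2) / 2 * (binet_norm L x)\<^sup>2"
  using second_moment_ge_width[OF compact_L convex_L uminus_L nn_integral_inner_square m_pos _ assms] by simp

lemma binet_norm_eq_0D:
  assumes "binet_norm L x = 0" shows "x = 0"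
proof -
  obtain d where d: "0 < d" "cball 0 d \<subseteq> L" using cball_subset_L by blast
  have "(d / (norm x + 1)) *\<^sub>R x \<in> cball 0 d"
  proof -
    have n: "0 < norm x + 1" by (simp add: add_nonneg_pos)
    have "d * (norm x / (norm x + 1)) \<le> d * 1" using d n by (intro mult_left_mono) auto
    then show ?thesis using d n by simp
  qed
  then have "(d / (norm x + 1)) *\<^sub>R x \<in> L" using d by blast
  from inner_square_le_binet[OF this, of x] assms
  have "(x \<bullet> (d / (norm x + 1)) *\<^sub>R x)\<^sup>2 \<le> 0" by simp
  then have "d / (norm x + 1) * (x \<bullet> x) = 0" by simp
  then show ?thesis using d by (auto simp: add_nonneg_eq_0_iff)
qed

lemma binet_norm_le_1:
  assumes x: "x \<in> K" shows "(binet_norm L x)\<^sup>2 \<le> 1"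
proof -
  have [measurable]: "L \<in> sets borel" by (simp add: closed_polar_body)
  have "(\<integral>\<^sup>+y. indicator L y * ennreal ((x \<bullet> y)\<^sup>2) \<partial>lborel) \<le> (\<integral>\<^sup>+y. indicator L y \<partial>lborel)"
    using abs_inner_le[OF x] by (intro nn_integral_mono) (auto simp: indicator_def abs_square_le_1)
  also have "\<dots> = ennreal m" using compact_fmeasurable[OF compact_L] by (simp add: emeasure_eq_measure2)
  finally have "ennreal ((binet_norm L x)\<^sup>2 * m) \<le> ennreal (1 * m)" by (simp add: nn_integral_inner_square)
  then have "(binet_norm L x)\<^sup>2 * m \<le> 1 * m" using m_pos by (subst (asm) ennreal_le_iff) auto
  then show ?thesis using m_pos by (simp only: mult_le_cancel_right_pos)
qed

text \<open>For \<open>y \<in> L\<close> one has \<open>\<bar>x \<bullet> y\<bar> < 1\<close> off two hyperplanes, so a minorant of the integrand that is quadratic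
  in \<open>s\<close> can be integrated, and its integral only depends on the Binet norm.\<close>

lemma emeasure_polar_ge:
  assumes x: "x \<in> K"
    and minorant: "\<And>s. \<bar>s\<bar> < 1 \<Longrightarrow> c + d * s\<^sup>2 \<le> sym_inverse_power (Suc DIM('a)) s"
  shows "ennreal (m * (c + d * (binet_norm L x)\<^sup>2)) \<le> emeasure lborel (polar_body K x)"
proof -
  have [measurable]: "L \<in> sets borel" by (simp add: closed_polar_body)
  define f where "f y = c * indicat_real L y + d * (indicat_real L y * (x \<bullet> y)\<^sup>2)" for y
  have iL: "integrable lborel (indicat_real L)"
    using compact_fmeasurable[OF compact_L] by (intro integrable_real_indicator) (auto simp: fmeasurable_def)
  have f: "integrable lborel f"
    unfolding f_def by (intro Bochner_Integration.integrable_add integrable_mult_right iL integrable_inner_square)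
  have "(\<integral>y. f y \<partial>lborel) = c * (\<integral>y. indicat_real L y \<partial>lborel) + d * (\<integral>y. indicat_real L y * (x \<bullet> y)\<^sup>2 \<partial>lborel)"
    unfolding f_def using iL integrable_inner_square by simp
  also have "\<dots> = m * (c + d * (binet_norm L x)\<^sup>2)"
    by (simp add: integral_inner_square algebra_simps)
  finally have "ennreal (m * (c + d * (binet_norm L x)\<^sup>2)) = ennreal (\<integral>y. f y \<partial>lborel)" by simp
  also have "\<dots> \<le> ennreal (\<integral>y. max 0 (f y) \<partial>lborel)"
    using f by (intro ennreal_leI integral_mono) auto
  also have "\<dots> = (\<integral>\<^sup>+y. ennreal (max 0 (f y)) \<partial>lborel)"
    using f by (intro nn_integral_eq_integral[symmetric]) auto
  also have "\<dots> \<le> (\<integral>\<^sup>+y. indicator L y * ennreal (sym_inverse_power (Suc DIM('a)) (x \<bullet> y)) \<partial>lborel)"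
  proof (rule nn_integral_mono_AE)
    have "AE y in lborel. x \<bullet> y \<noteq> 1" "AE y in lborel. x \<bullet> y \<noteq> - 1"
      by (intro AE_lborel_inner_neq; simp)+
    then show "AE y in lborel. ennreal (max 0 (f y)) \<le> indicator L y * ennreal (sym_inverse_power (Suc DIM('a)) (x \<bullet> y))"
    proof eventually_elim
      fix y assume s: "x \<bullet> y \<noteq> 1" "x \<bullet> y \<noteq> - 1"
      show "ennreal (max 0 (f y)) \<le> indicator L y * ennreal (sym_inverse_power (Suc DIM('a)) (x \<bullet> y))"
      proof (cases "y \<in> L")
        case True
        then have "\<bar>x \<bullet> y\<bar> < 1" using abs_inner_le[OF x True] s by linarith
        from minorant[OF this] True show ?thesis by (auto simp: f_def max_def intro: ennreal_leI)
      qed (simp add: f_def)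
    qed
  qed
  finally show ?thesis by (simp add: emeasure_polar_symmetrised[OF x])
qed

lemma emeasure_polar_ge_quadratic:
  assumes x: "x \<in> K"
  shows "ennreal (m * (1 + (real DIM('a) + 1) * (real DIM('a) + 2) / 2 * (binet_norm L x)\<^sup>2))
    \<le> emeasure lborel (polar_body K x)"
proof (rule emeasure_polar_ge[OF x])
  fix s :: real assume "\<bar>s\<bar> < 1"
  from inverse_power_quadratic(1)[OF this, of "Suc DIM('a)"]
  show "1 + (real DIM('a) + 1) * (real DIM('a) + 2) / 2 * s\<^sup>2 \<le> sym_inverse_power (Suc DIM('a)) s"
    by (simp add: algebra_simps)
qed

text \<open>Jensen's inequality for the convex function \<open>w\<^bsup>-(n+1)\<^esup>\<close> of \<open>w = 1 - s\<^sup>2/2\<close>, whose mean is \<open>b\<close>: the minorant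
  is its tangent at \<open>b\<close>, which is quadratic in \<open>s\<close>.\<close>

lemma emeasure_polar_ge_power:
  assumes x: "x \<in> K"
  shows "ennreal (m / (1 - (binet_norm L x)\<^sup>2 / 2) ^ Suc DIM('a)) \<le> emeasure lborel (polar_body K x)"
proof -
  define a where "a = (binet_norm L x)\<^sup>2"
  define b where "b = 1 - a / 2"
  have b: "0 < b" using binet_norm_le_1[OF x] by (simp add: b_def a_def)
  let ?k = "Suc DIM('a)"
  define d where "d = 1 / b ^ ?k * (real ?k / (2 * b))"
  have "ennreal (m * ((1 / b ^ ?k - d * a) + d * (binet_norm L x)\<^sup>2)) \<le> emeasure lborel (polar_body K x)"
  proof (rule emeasure_polar_ge[OF x])
    fix s :: real assume s: "\<bar>s\<bar> < 1"
    then have "s\<^sup>2 < 1" by (simp add: abs_square_less_1)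
    then have w: "0 < 1 - s\<^sup>2 / 2" by simp
    have "1 / b ^ ?k - d * a + d * s\<^sup>2 = 1 / b ^ ?k * (1 + real ?k * ((s\<^sup>2 - a) / (2 * b)))"
    proof -
      have "A - A * (k / (2 * b)) * a + A * (k / (2 * b)) * y = A * (1 + k * ((y - a) / (2 * b)))" for A k y :: real
        by (simp add: algebra_simps diff_divide_distrib)
      then show ?thesis unfolding d_def .
    qed
    also have "(s\<^sup>2 - a) / (2 * b) = 1 - (1 - s\<^sup>2 / 2) / b"
      using b by (simp add: field_simps) (simp add: b_def)
    also have "1 / b ^ ?k * (1 + real ?k * (1 - (1 - s\<^sup>2 / 2) / b)) \<le> 1 / (1 - s\<^sup>2 / 2) ^ ?k"
      by (rule inverse_power_tangent[OF b w])
    also have "\<dots> \<le> sym_inverse_power ?k s" by (rule sym_inverse_power_ge_inverse_power[OF s])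
    finally show "1 / b ^ ?k - d * a + d * s\<^sup>2 \<le> sym_inverse_power ?k s" .
  qed
  then show ?thesis by (simp add: a_def[symmetric] b_def[symmetric])
qed

lemma emeasure_polar_le:
  assumes small: "(real DIM('a) + 1) * (real DIM('a) + 2) / 2 * (binet_norm L x)\<^sup>2 < 1"
  shows "x \<in> K" and "emeasure lborel (polar_body K x)
    \<le> ennreal (m / (1 - (real DIM('a) + 1) * (real DIM('a) + 2) / 2 * (binet_norm L x)\<^sup>2))"
proof -
  show x: "x \<in> K"
  proof (rule bipolar)
    fix y assume "y \<in> L"
    from inner_square_le_binet[OF this, of x] small have "(x \<bullet> y)\<^sup>2 < 1" by linarith
    then show "x \<bullet> y \<le> 1" by (simp add: abs_square_less_1)
  qed
  show "emeasure lborel (polar_body K x)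
    \<le> ennreal (m / (1 - (real DIM('a) + 1) * (real DIM('a) + 2) / 2 * (binet_norm L x)\<^sup>2))"
    unfolding emeasure_polar_symmetrised[OF x]
    by (rule nn_integral_inverse_power_le[OF compact_L convex_L uminus_L nn_integral_inner_square m_pos zero_le_power2 small])
qed

section \<open>Santalo regions of a symmetric body\<close>

abbreviation P :: real where "P \<equiv> volume_product K"

lemma v_pos: "0 < euclidean_ball_vol TYPE('a)"
  using content_cball_pos[of 1 "0::'a"] by (simp add: euclidean_ball_vol_def)

lemma P_eq: "P = measure lborel K * m"
  by (simp add: volume_product_def borel_compact compact_K closed_polar_body)

lemma P_pos: "0 < P"
  using volume_K_pos m_pos by (simp add: P_eq)

text \<open>Since \<open>K\<close> has positive volume, a real bound on the extended product forces the polar body to have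
  finite volume, and the condition becomes one on real numbers.\<close>

lemma region_condition_iff:
  "x \<in> santalo_region K t \<longleftrightarrow> x \<in> K \<and>
    (\<exists>e\<ge>0. emeasure lborel (polar_body K x) = ennreal e \<and> measure lborel K * e / (euclidean_ball_vol TYPE('a))\<^sup>2 \<le> t)"
proof -
  let ?V = "measure lborel K" and ?E = "emeasure lborel (polar_body K x)"
  have K: "emeasure lebesgue K = ennreal ?V" "emeasure lebesgue (polar_body K x) = ?E"
    using compact_fmeasurable[OF compact_K] by (simp_all add: emeasure_eq_measure2 borel_compact compact_K closed_polar_body)
  have val: "enn2ereal (ennreal ?V * ennreal e / ennreal ((euclidean_ball_vol TYPE('a))\<^sup>2)) = ereal (?V * e / (euclidean_ball_vol TYPE('a))\<^sup>2)" if "0 \<le> e" for e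
    using that v_pos by (simp add: divide_ennreal flip: ennreal_mult)
  have "enn2ereal (ennreal ?V * ?E / ennreal ((euclidean_ball_vol TYPE('a))\<^sup>2)) \<le> ereal t \<longleftrightarrow> (\<exists>e\<ge>0. ?E = ennreal e \<and> ?V * e / (euclidean_ball_vol TYPE('a))\<^sup>2 \<le> t)"
  proof (cases ?E)
    case (real e)
    then show ?thesis using val[of e] by auto
  next
    case top
    then show ?thesis using volume_K_pos by (auto simp: ennreal_mult_top ennreal_top_divide)
  qed
  then show ?thesis by (simp add: santalo_region_def K)
qed

lemma region_polar_volume_le:
  assumes "x \<in> santalo_region K t" and "0 \<le> e" and "ennreal e \<le> emeasure lborel (polar_body K x)"
  shows "measure lborel K * e \<le> t * (euclidean_ball_vol TYPE('a))\<^sup>2"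
proof -
  obtain e' where e': "0 \<le> e'" "emeasure lborel (polar_body K x) = ennreal e'" "measure lborel K * e' / (euclidean_ball_vol TYPE('a))\<^sup>2 \<le> t"
    using assms(1) unfolding region_condition_iff by blast
  have "e \<le> e'" using assms(3) e'(1) unfolding e'(2) by simp
  then have "measure lborel K * e \<le> measure lborel K * e'" by (intro mult_left_mono) auto
  also have "\<dots> \<le> t * (euclidean_ball_vol TYPE('a))\<^sup>2" using e'(3) v_pos by (simp add: pos_divide_le_eq)
  finally show ?thesis .
qed

lemma region_memI:
  assumes "x \<in> K" "emeasure lborel (polar_body K x) \<le> ennreal e" "0 \<le> e" "measure lborel K * e \<le> t * (euclidean_ball_vol TYPE('a))\<^sup>2"
  shows "x \<in> santalo_region K t"
proof -
  obtain e' where e': "0 \<le> e'" "emeasure lborel (polar_body K x) = ennreal e'" "e' \<le> e"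
    using assms(2,3) by (cases "emeasure lborel (polar_body K x)") (auto simp: top_unique)
  have "measure lborel K * e' \<le> t * (euclidean_ball_vol TYPE('a))\<^sup>2" using e'(3) assms(4) by (meson measure_nonneg mult_left_mono order_trans)
  then have "measure lborel K * e' / (euclidean_ball_vol TYPE('a))\<^sup>2 \<le> t" using v_pos by (simp add: pos_divide_le_eq)
  then show ?thesis using assms(1) e' unfolding region_condition_iff by blast
qed

lemma volume_product_le_of_region:
  assumes "x \<in> santalo_region K t" shows "P \<le> t * (euclidean_ball_vol TYPE('a))\<^sup>2"
proof -
  have x: "x \<in> K" using assms by (simp add: santalo_region_def)
  have "ennreal m \<le> ennreal (m * (1 + (real DIM('a) + 1) * (real DIM('a) + 2) / 2 * (binet_norm L x)\<^sup>2))"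
    by (intro ennreal_leI) (simp add: distrib_left)
  also note emeasure_polar_ge_quadratic[OF x]
  finally show ?thesis using region_polar_volume_le[OF assms, of m] m_pos by (simp add: P_eq)
qed

lemma mem_scaled_ellipsoid:
  assumes "binet_norm L x \<le> c" "0 \<le> c"
  shows "x \<in> (\<lambda>u. c *\<^sub>R u) ` binet_ellipsoid L"
proof (cases "c = 0")
  case True
  then have "x = 0" using assms binet_norm_nonneg[of x] binet_norm_eq_0D[of x] by simp
  moreover have "0 \<in> binet_ellipsoid L"
    using binet_norm_scale[of 0 0] by (simp add: binet_ellipsoid_def)
  ultimately show ?thesis by force
next
  case False
  then have "(1 / c) *\<^sub>R x \<in> binet_ellipsoid L"
    using assms by (simp add: binet_ellipsoid_def binet_norm_scale divide_le_eq)
  then show ?thesis using False by (intro rev_image_eqI[of "(1 / c) *\<^sub>R x"]) auto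
qed

text \<open>In terms of \<open>q = P / (t * v\<^sup>2)\<close>, where \<open>v\<close> is the volume of the unit ball, every lower bound \<open>m * e\<close> for the
  volume of the polar body at \<open>x\<close> yields \<open>e \<le> 1/q\<close>. The two lower bounds give the two terms of the
  minimum.\<close>

theorem region_subset_outer:
  assumes P: "P \<le> t * (euclidean_ball_vol TYPE('a))\<^sup>2" and x: "x \<in> santalo_region K t"
  shows "x \<in> (\<lambda>u. outer_factor K t *\<^sub>R u) ` binet_ellipsoid L"
proof (rule mem_scaled_ellipsoid)
  let ?n = "real DIM('a)"
  define q where "q = P / (t * (euclidean_ball_vol TYPE('a))\<^sup>2)"
  have tv: "0 < t * (euclidean_ball_vol TYPE('a))\<^sup>2" using P P_pos by linarith
  have q: "0 < q" "q \<le> 1" using P P_pos tv by (simp_all add: q_def)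
  have q': "t * (euclidean_ball_vol TYPE('a))\<^sup>2 / P = 1 / q" by (simp add: q_def)
  have V: "measure lborel K * (m * e) \<le> t * (euclidean_ball_vol TYPE('a))\<^sup>2 \<Longrightarrow> e \<le> 1 / q" for e
    using P_pos unfolding q'[symmetric] P_eq by (simp add: pos_le_divide_eq mult_ac)
  define a where "a = (binet_norm L x)\<^sup>2"
  have xK: "x \<in> K" using x by (simp add: santalo_region_def)
  have a: "0 \<le> a" "a \<le> 1" using binet_norm_le_1[OF xK] by (simp_all add: a_def)
  have norm: "binet_norm L x = sqrt a" using binet_norm_nonneg by (simp add: a_def)
  define N where "N = (?n + 1) * (?n + 2) / 2"
  have N: "0 < N" by (simp add: N_def add_pos_pos)
  have "1 + N * a \<le> 1 / q"
    using emeasure_polar_ge_quadratic[OF xK] N a m_pos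
    by (intro V region_polar_volume_le[OF x]) (auto simp: N_def a_def)
  then have "a \<le> (1 / q - 1) / N" using N by (simp add: pos_le_divide_eq mult.commute)
  also have "(1 / q - 1) / N = 2 / ((?n + 1) * (?n + 2)) * (1 / q) * (1 - q)"
    using q by (simp add: N_def field_simps)
  finally have bound1: "binet_norm L x \<le> sqrt (2 / ((?n + 1) * (?n + 2))) * sqrt (1 / q) * sqrt (1 - q)"
    unfolding norm real_sqrt_mult[symmetric] by (rule real_sqrt_le_mono)
  define b where "b = 1 - a / 2"
  have b: "0 < b" "b \<le> 1" using a by (simp_all add: b_def)
  have "1 / b ^ Suc DIM('a) \<le> 1 / q"
    using emeasure_polar_ge_power[OF xK] b m_pos
    by (intro V region_polar_volume_le[OF x]) (auto simp: b_def a_def simp del: power_Suc)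
  then have "q \<le> b ^ Suc DIM('a)" using q b by (simp add: field_simps del: power_Suc)
  also have "\<dots> \<le> b ^ DIM('a)" using b by (intro power_decreasing) auto
  finally have "q powr (1 / ?n) \<le> (b ^ DIM('a)) powr (1 / ?n)" using q by (intro powr_mono2) auto
  also have "\<dots> = b" using b by (simp add: powr_powr flip: powr_realpow)
  finally have "a \<le> 2 * (1 - q powr (1 / ?n))" by (simp add: b_def)
  then have bound2: "binet_norm L x \<le> sqrt 2 * sqrt (1 - q powr (1 / ?n))"
    unfolding norm real_sqrt_mult[symmetric] by (rule real_sqrt_le_mono)
  have c: "outer_factor K t = min (sqrt (2 / ((?n + 1) * (?n + 2))) * sqrt (1 / q) * sqrt (1 - q))
      (sqrt 2 * sqrt (1 - q powr (1 / ?n)))"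
    by (simp only: outer_factor_def Let_def q' q_def[symmetric])
  show "binet_norm L x \<le> outer_factor K t" unfolding c using bound1 bound2 by simp
  then show "0 \<le> outer_factor K t" using binet_norm_nonneg[of x] by linarith
qed

text \<open>The factor 3 in the definition of \<open>inner_factor\<close> enters through \<open>(n+1)(n+2)/2 \<le> 3 n\<^sup>2\<close>, which is
  equivalent to \<open>0 \<le> (5 n + 2) (n - 1)\<close>; equality holds for \<open>n = 1\<close>.\<close>

theorem inner_subset_region:
  assumes P: "P \<le> t * (euclidean_ball_vol TYPE('a))\<^sup>2" and u: "u \<in> binet_ellipsoid L"
  shows "inner_factor K t *\<^sub>R u \<in> santalo_region K t"
proof -
  let ?n = "real DIM('a)" and ?x = "inner_factor K t *\<^sub>R u"
  define q where "q = P / (t * (euclidean_ball_vol TYPE('a))\<^sup>2)"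
  have tv: "0 < t * (euclidean_ball_vol TYPE('a))\<^sup>2" using P P_pos by linarith
  have q: "0 < q" "q \<le> 1" using P P_pos tv by (simp_all add: q_def)
  have n: "1 \<le> ?n" using DIM_positive[where 'a='a] by linarith
  define a where "a = (binet_norm L ?x)\<^sup>2"
  have d: "(inner_factor K t)\<^sup>2 = (1 - q) / (3 * ?n\<^sup>2)"
    using q by (simp add: inner_factor_def q_def[symmetric] power_mult_distrib power_divide)
  have "a = (inner_factor K t)\<^sup>2 * (binet_norm L u)\<^sup>2"
    by (simp add: a_def binet_norm_scale power_mult_distrib)
  also have "\<dots> \<le> (inner_factor K t)\<^sup>2 * 1"
    using u binet_norm_nonneg[of u] by (intro mult_left_mono) (auto simp: binet_ellipsoid_def power_le_one)
  finally have a: "a \<le> (1 - q) / (3 * ?n\<^sup>2)" by (simp add: d)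
  define N where "N = (?n + 1) * (?n + 2) / 2"
  have N: "0 \<le> N" "N \<le> 3 * ?n\<^sup>2"
  proof -
    have "0 \<le> (5 * ?n + 2) * (?n - 1)" using n by (intro mult_nonneg_nonneg) auto
    then show "N \<le> 3 * ?n\<^sup>2" by (simp add: N_def power2_eq_square algebra_simps)
  qed (simp add: N_def)
  have "N * a \<le> 3 * ?n\<^sup>2 * ((1 - q) / (3 * ?n\<^sup>2))"
    using N a by (intro mult_mono) (auto simp: a_def)
  also have "\<dots> = 1 - q" using n by simp
  finally have Na: "N * a \<le> 1 - q" .
  have small: "N * a < 1" using Na q by linarith
  show ?thesis
  proof (rule region_memI)
    show "?x \<in> K" using emeasure_polar_le(1)[of ?x] small by (simp add: N_def a_def)
    have "emeasure lborel (polar_body K ?x) \<le> ennreal (m / (1 - N * a))"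
      using emeasure_polar_le(2)[of ?x] small by (simp add: N_def a_def)
    also have "\<dots> \<le> ennreal (m / q)"
      using Na q m_pos by (intro ennreal_leI divide_left_mono) auto
    finally show "emeasure lborel (polar_body K ?x) \<le> ennreal (m / q)" .
    show "0 \<le> m / q" using m_pos q by simp
    have "measure lborel K * (m / q) = P / q" by (simp add: P_eq)
    also have "\<dots> = t * (euclidean_ball_vol TYPE('a))\<^sup>2" using P_pos by (simp add: q_def)
    finally show "measure lborel K * (m / q) \<le> t * (euclidean_ball_vol TYPE('a))\<^sup>2" by simp
  qed
qed

theorem region_nonempty_iff: "santalo_region K t \<noteq> {} \<longleftrightarrow> P / (euclidean_ball_vol TYPE('a))\<^sup>2 \<le> t"
proof
  assume "santalo_region K t \<noteq> {}"
  then show "P / (euclidean_ball_vol TYPE('a))\<^sup>2 \<le> t" using volume_product_le_of_region v_pos by (auto simp: pos_divide_le_eq)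
next
  assume "P / (euclidean_ball_vol TYPE('a))\<^sup>2 \<le> t"
  then have P: "P \<le> t * (euclidean_ball_vol TYPE('a))\<^sup>2" using v_pos by (simp add: pos_divide_le_eq)
  have "0 \<in> binet_ellipsoid L" using binet_norm_scale[of 0 0] by (simp add: binet_ellipsoid_def)
  from inner_subset_region[OF P this] show "santalo_region K t \<noteq> {}" by blast
qed

end

theorem theorem6:
  fixes K :: "(real ^ 'n) set"
  assumes "convex_body K"
    and "K = uminus ` K"
  shows "\<forall>t::real.
           (santalo_region K t \<noteq> {} \<longleftrightarrow>
              volume_product K / (euclidean_ball_vol TYPE(real ^ 'n))\<^sup>2 \<le> t) \<and>
           (santalo_region K t \<noteq> {} \<longrightarrow>
              (\<lambda>u. inner_factor K t *\<^sub>R u) ` binet_ellipsoid (polar_body K 0)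
                \<subseteq> santalo_region K t \<and>
              santalo_region K t
                \<subseteq> (\<lambda>u. outer_factor K t *\<^sub>R u) ` binet_ellipsoid (polar_body K 0))"
proof -
  interpret symmetric_body K by unfold_locales (fact assms)+
  show ?thesis
    using region_nonempty_iff volume_product_le_of_region inner_subset_region region_subset_outer by blast
qed

end
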